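(* Consider the bilinear system on $\mathrm{SO}(n)$ $$\dot X(t)=AX(t)+\Big(\sum_{k=1}^m u_k(t)B_{i_kj_k}\Big)X(t),\qquad X(0)=I_n,$$ with $A\in\mathfrak{so}(n)$ and $B_{i_kj_k}\in\{B_{ij}:1\le i<j\le n\}$ for $k=1,\dots,m$. Suppose each connected component of $\mathrm{G}_{\rm contr}$ contains at least three nodes. Then the system is controllable on the Lie group $\mathrm{SO}(n)$ if and only if the union graph $\mathrm{G}_{\rm drift}\cup\mathrm{G}_{\rm contr}:=(\mathrm{V},\mathrm{E}_{\rm drift}\cup\mathrm{E}_{\rm contr})$ is connected.
   Context: $\mathrm{SO}(n)$ is the group of real orthogonal $n\times n$ matrices of determinant one, and $\mathfrak{so}(n)$ is its Lie algebra of real skew-symmetric $n\times n$ matrices. $E_{ij}\in\mathbb{R}^{n\times n}$ has $(i,j)$-entry $1$ and all other entries $0$, and $B_{ij}=E_{ij}-E_{ji}$. The controls $u_k(t)\in\mathbb{R}$ are piecewise constant signals. For $T\ge 0$, $\mathcal{R}_T(I_n)$ is the set of all terminal points $X(T)$ of solutions of the system with $X(0)=I_n$ (over all admissible controls), and $\mathcal{R}(I_n)=\bigcup_{T\ge 0}\mathcal{R}_T(I_n)$. The system is controllable on $\mathrm{SO}(n)$ if $\mathcal{R}(I_n)=\mathrm{SO}(n)$. Let $\mathrm{V}=\{1,\dots,n\}$. The drift interaction graph is the undirected graph $\mathrm{G}_{\rm drift}=(\mathrm{V},\mathrm{E}_{\rm drift})$ where $\{i,j\}\in\mathrm{E}_{\rm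 drift}$ if and only if $[A]_{ij}=-[A]_{ji}\ne 0$. The controlled interaction graph is the undirected graph $\mathrm{G}_{\rm contr}=(\mathrm{V},\mathrm{E}_{\rm contr})$ with $\mathrm{E}_{\rm contr}=\{\{i_1,j_1\},\dots,\{i_m,j_m\}\}$. A graph is connected if every two distinct nodes are joined by a path; connected components are taken in the usual sense on the full node set $\mathrm{V}$ (so an isolated node is a component with one node). *)

theory Defs
  imports "HOL-Analysis.Analysis"
begin

section \<open>Matrices\<close>

definition SO_group :: "(real^'n^'n) set" where
  "SO_group = {Q. orthogonal_matrix Q \<and> det Q = 1}"

definition so_algebra :: "(real^'n^'n) set" where
  "so_algebra = {A. transpose A = - A}"

definition unit_mat :: "'n::finite \<Rightarrow> 'n \<Rightarrow> real^'n^'n" where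
  "unit_mat i j = (\<chi> a b. if a = i \<and> b = j then 1 else 0)"

definition skew_mat :: "'n::finite \<Rightarrow> 'n \<Rightarrow> real^'n^'n" where
  "skew_mat i j = unit_mat i j - unit_mat j i"


section \<open>The bilinear control system\<close>

text \<open>The values of a piecewise constant signal at its finitely many switching times are
  unconstrained; they do not affect the solutions below.\<close>

definition piecewise_constant_on :: "(real \<Rightarrow> real) \<Rightarrow> real \<Rightarrow> real \<Rightarrow> bool" where
  "piecewise_constant_on u a b \<longleftrightarrow>
     (\<exists>S. finite S \<and> (\<forall>s t. {s<..<t} \<subseteq> {a..b} - S \<longrightarrow> u constant_on {s<..<t}))"

text \<open>A solution on \<open>[0,T]\<close> is a continuous curve that satisfies the differential equation except
  at finitely many times, since the right-hand side jumps where the controls switch.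
  The \<open>k\<close>-th controlled direction is \<open>skew_mat (i k) (j k)\<close>, for \<open>k = 1, \<dots>, m\<close>.\<close>

definition is_solution ::
  "real^'n^'n \<Rightarrow> nat \<Rightarrow> (nat \<Rightarrow> 'n) \<Rightarrow> (nat \<Rightarrow> 'n) \<Rightarrow> (nat \<Rightarrow> real \<Rightarrow> real) \<Rightarrow>
     real \<Rightarrow> (real \<Rightarrow> real^'n^'n) \<Rightarrow> bool" where
  "is_solution A m i j u T X \<longleftrightarrow>
     continuous_on {0..T} X \<and> X 0 = mat 1 \<and>
     (\<exists>S. finite S \<and> (\<forall>t\<in>{0..T} - S.
        (X has_vector_derivative
           (A ** X t + (\<Sum>k=1..m. u k t *\<^sub>R skew_mat (i k) (j k)) ** X t))
        (at t within {0..T})))"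

definition reachable_at ::
  "real^'n^'n \<Rightarrow> nat \<Rightarrow> (nat \<Rightarrow> 'n) \<Rightarrow> (nat \<Rightarrow> 'n) \<Rightarrow> real \<Rightarrow> (real^'n^'n) set" where
  "reachable_at A m i j T =
     {X T | X u. (\<forall>k\<in>{1..m}. piecewise_constant_on (u k) 0 T) \<and> is_solution A m i j u T X}"

definition reachable ::
  "real^'n^'n \<Rightarrow> nat \<Rightarrow> (nat \<Rightarrow> 'n) \<Rightarrow> (nat \<Rightarrow> 'n) \<Rightarrow> (real^'n^'n) set" where
  "reachable A m i j = (\<Union>T\<in>{0..}. reachable_at A m i j T)"

definition controllable ::
  "real^'n^'n \<Rightarrow> nat \<Rightarrow> (nat \<Rightarrow> 'n) \<Rightarrow> (nat \<Rightarrow> 'n) \<Rightarrow> bool" where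
  "controllable A m i j \<longleftrightarrow> reachable A m i j = SO_group"


section \<open>Interaction graphs\<close>

text \<open>The node set is all of the index type; a graph is given by its set of edges \<open>{x, y}\<close>.\<close>

definition adjacency :: "'v set set \<Rightarrow> ('v \<times> 'v) set" where
  "adjacency E = {(x, y). {x, y} \<in> E}"

definition joined :: "'v set set \<Rightarrow> ('v \<times> 'v) set" where
  "joined E = (adjacency E)\<^sup>*"

lemma equiv_joined: "equiv UNIV (joined E)"
proof -
  have "sym (adjacency E)"
    by (auto simp: sym_def adjacency_def insert_commute)
  then show ?thesis
    unfolding joined_def by (intro equivI refl_rtrancl sym_rtrancl trans_rtrancl) auto
qed

definition connected_graph :: "'v set set \<Rightarrow> bool" where
  "connected_graph E \<longleftrightarrow> (\<forall>x y. x \<noteq> y \<longrightarrow> (x, y) \<in> joined E)"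

definition graph_components :: "'v set set \<Rightarrow> 'v set set" where
  "graph_components E = UNIV // joined E"

definition drift_edges :: "real^'n^'n \<Rightarrow> 'n set set" where
  "drift_edges A = {{p, q} | p q. A $ p $ q = - (A $ q $ p) \<and> A $ p $ q \<noteq> 0}"

definition contr_edges :: "nat \<Rightarrow> (nat \<Rightarrow> 'n) \<Rightarrow> (nat \<Rightarrow> 'n) \<Rightarrow> 'n set set" where
  "contr_edges m i j = {{i k, j k} | k. k \<in> {1..m}}"

end

theory Submission
  imports Defs
begin

text \<open>
Every solution lies in \<open>SO(n)\<close>, and if the union graph splits the nodes into two parts, then all
right-hand sides are block diagonal for that splitting, so every reachable matrix is block diagonal
as well, which a quarter turn between the two parts is not (\<open>controllable_imp_connected\<close>).

For the converse let \<open>R\<close> be the reachable set, a semigroup in \<open>SO(n)\<close>. Exact statements about \<open>R\<close> are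
awkward, because a rotation generated by a control alone is only a limit of reachable matrices: the
control must be large to drown the drift. The proof therefore works with maps that are uniform limits
of continuous \<open>R\<close>-valued maps (\<open>approximable\<close>) and with the set of velocities at \<open>1\<close> of approximable
curves (\<open>tangent_cone\<close>). This set is a convex cone, because multiplying curves adds velocities,
and it is stable under conjugation by elements of the closure of \<open>R\<close> that have their inverse there;
it contains the drift \<open>A\<close> and both signs of every controlled direction.

Call two nodes rotatable if the cone contains both signs of \<open>B\<^sub>p\<^sub>q\<close>. Then all rotations in the plane of
\<open>p\<close> and \<open>q\<close> lie in the closure of \<open>R\<close>, and conjugation by quarter turns makes the relation
transitive, so every component of the controlled graph is rotatable. Now let \<open>p\<close>, \<open>q\<close> be joined by a
drift edge between two different classes. Conjugation by the half turn of a rotatable pair flips the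
signs of two rows and columns; averaging \<open>A\<close> over such flips kills every entry between different
classes other than the entries at \<open>p\<close>, \<open>q\<close>. Here three nodes per component are used: a node outside
\<open>{p, q}\<close> must have a partner in its own class that is also outside \<open>{p, q}\<close>. The entries inside the
classes can be subtracted, and what is left is a multiple of \<open>B\<^sub>p\<^sub>q\<close>, whose sign can again be flipped
(\<open>drift_edge_rotatable\<close>). If the union graph is connected, all pairs are therefore rotatable.

Two facts then give \<open>R = SO(n)\<close>. First, \<open>R\<close> is dense (\<open>dense_if_all_rotatable\<close>): given \<open>Q\<close>, a maximiser
\<open>P\<close> of a weighted trace of \<open>Q P\<close> on the compact closure of \<open>R\<close> satisfies \<open>Q P = 1\<close>. Secondly, \<open>R\<close> contains
a neighbourhood of \<open>1\<close> (\<open>contains_neighbourhood_of_identity\<close>): multiplying curves with velocities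
\<open>B\<^sub>p\<^sub>q\<close>, each run for a time read off from a skew matrix, gives an approximable map from skew matrices to
\<open>SO(n)\<close> whose derivative at \<open>0\<close> is the identity, and by Brouwer's fixed point theorem a nearby \<open>R\<close>-valued continuous map still hits every matrix
near \<open>1\<close>. Finally each \<open>Q\<close> is \<open>(Q P\<^sup>-\<^sup>1) P\<close> with \<open>P\<close> in \<open>R\<close> so close to \<open>Q\<close> that \<open>Q P\<^sup>-\<^sup>1\<close> is near \<open>1\<close>.
\<close>

section \<open>The matrix norm and the rotation group\<close>

text \<open>The norm of the matrix type is the Frobenius norm, so it is invariant under multiplication by
  orthogonal matrices on either side; this is what keeps all error estimates below additive.\<close>
lemma inner_matrix_trace:
  fixes M N :: "real^'n^'m"
  shows "inner M N = trace (transpose M ** N)"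
proof -
  have "inner M N = (\<Sum>a\<in>UNIV. \<Sum>b\<in>UNIV. M$a$b * N$a$b)"
    by (simp add: inner_vec_def)
  also have "\<dots> = (\<Sum>b\<in>UNIV. \<Sum>a\<in>UNIV. M$a$b * N$a$b)"
    by (rule sum.swap)
  finally show ?thesis
    by (simp add: trace_def matrix_matrix_mult_def transpose_def)
qed

lemma norm_transpose: "norm (transpose M) = norm (M :: real^'n^'m)"
proof -
  have "inner (transpose M) (transpose M) = (\<Sum>a\<in>UNIV. \<Sum>b\<in>UNIV. M$b$a * M$b$a)"
    by (simp add: inner_vec_def transpose_def)
  also have "\<dots> = (\<Sum>b\<in>UNIV. \<Sum>a\<in>UNIV. M$b$a * M$b$a)"
    by (rule sum.swap)
  also have "\<dots> = inner M M"
    by (simp add: inner_vec_def)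
  finally show ?thesis
    by (simp add: norm_eq_sqrt_inner)
qed

lemma norm_matrix_mult_le:
  fixes M :: "real^'k^'m" and N :: "real^'n^'k"
  shows "norm (M ** N) \<le> norm M * norm N"
proof -
  have e: "(M ** N)$a$b = inner (M$a) (column b N)" for a b
    by (simp add: matrix_matrix_mult_def inner_vec_def column_def)
  have "(norm (M ** N))\<^sup>2 = (\<Sum>a\<in>UNIV. \<Sum>b\<in>UNIV. ((M ** N)$a$b)\<^sup>2)"
    unfolding power2_norm_eq_inner inner_vec_def by (simp add: power2_eq_square)
  also have "\<dots> \<le> (\<Sum>a\<in>UNIV. \<Sum>b\<in>UNIV. inner (M$a) (M$a) * inner (column b N) (column b N))"
    unfolding e by (intro sum_mono Cauchy_Schwarz_ineq)
  also have "\<dots> = (\<Sum>a\<in>UNIV. inner (M$a) (M$a)) * (\<Sum>b\<in>UNIV. inner (column b N) (column b N))"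
    by (simp add: sum_product)
  also have "(\<Sum>a\<in>UNIV. inner (M$a) (M$a)) = (norm M)\<^sup>2"
    by (simp add: power2_norm_eq_inner inner_vec_def)
  also have "(\<Sum>b\<in>UNIV. inner (column b N) (column b N)) = (norm (transpose N))\<^sup>2"
    by (simp add: power2_norm_eq_inner inner_vec_def column_def transpose_def)
  finally have "(norm (M ** N))\<^sup>2 \<le> (norm M * norm N)\<^sup>2"
    by (simp add: norm_transpose power_mult_distrib)
  then show ?thesis
    by (rule power2_le_imp_le) simp
qed

lemma bounded_bilinear_matrix_mult:
  "bounded_bilinear ((**) :: real^'k^'m \<Rightarrow> real^'n^'k \<Rightarrow> real^'n^'m)"
proof
  show "\<exists>K. \<forall>M N. norm ((M::real^'k^'m) ** (N::real^'n^'k)) \<le> norm M * norm N * K"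
    by (rule exI[of _ 1]) (simp add: norm_matrix_mult_le)
qed (simp_all add: matrix_matrix_mult_def vec_eq_iff sum.distrib algebra_simps sum_distrib_left)

interpretation mm: bounded_bilinear "(**) :: real^'k^'m \<Rightarrow> real^'n^'k \<Rightarrow> real^'n^'m"
  by (rule bounded_bilinear_matrix_mult)

lemma bounded_linear_transpose: "bounded_linear (transpose :: real^'n^'m \<Rightarrow> real^'m^'n)"
proof (rule bounded_linear_intro[where K = 1])
  show "norm (transpose M) \<le> norm M * 1" for M :: "real^'n^'m"
    by (simp add: norm_transpose)
qed (simp_all add: transpose_def vec_eq_iff)

lemmas continuous_on_transpose = bounded_linear.continuous_on[OF bounded_linear_transpose]
lemmas has_vector_derivative_transpose = bounded_linear.has_vector_derivative[OF bounded_linear_transpose]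
lemmas transpose_add = linear_add[OF bounded_linear.linear[OF bounded_linear_transpose]]
lemmas transpose_diff = linear_diff[OF bounded_linear.linear[OF bounded_linear_transpose]]
lemmas transpose_minus = linear_neg[OF bounded_linear.linear[OF bounded_linear_transpose]]

lemma norm_orthogonal_mult_left:
  fixes Q :: "real^'m^'m" and M :: "real^'n^'m"
  assumes "orthogonal_matrix Q"
  shows "norm (Q ** M) = norm M"
proof -
  have "transpose (Q ** M) ** (Q ** M) = transpose M ** ((transpose Q ** Q) ** M)"
    by (simp add: matrix_transpose_mul matrix_mul_assoc)
  also have "\<dots> = transpose M ** M"
    using assms by (simp add: orthogonal_matrix_def)
  finally show ?thesis
    by (simp add: norm_eq_sqrt_inner inner_matrix_trace)
qed

lemma norm_orthogonal_mult_right: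
  fixes Q :: "real^'n^'n" and M :: "real^'n^'m"
  assumes "orthogonal_matrix Q"
  shows "norm (M ** Q) = norm M"
proof -
  have "norm (transpose (M ** Q)) = norm (transpose M)"
    using assms by (simp add: matrix_transpose_mul norm_orthogonal_mult_left)
  then show ?thesis
    by (simp add: norm_transpose)
qed

text \<open>Errors of factors add up in a product, with constant one, because
  \<open>P Q - R S = (P - R) Q + R (Q - S)\<close>.\<close>
lemma norm_diff_orthogonal_products:
  fixes P Q R S :: "real^'n^'n"
  assumes "orthogonal_matrix Q" "orthogonal_matrix R"
  shows "norm (P ** Q - R ** S) \<le> norm (P - R) + norm (Q - S)"
proof -
  have "P ** Q - R ** S = (P - R) ** Q + R ** (Q - S)"
    by (simp add: mm.diff_left mm.diff_right)
  also have "norm \<dots> \<le> norm ((P - R) ** Q) + norm (R ** (Q - S))"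
    by (rule norm_triangle_ineq)
  finally show ?thesis
    using assms by (simp add: norm_orthogonal_mult_left norm_orthogonal_mult_right)
qed

lemma orthogonal_matrix_compact: "compact {Q :: real^'n^'n. orthogonal_matrix Q}"
proof -
  have "norm Q = norm (mat 1 :: real^'n^'n)" if "orthogonal_matrix Q" for Q :: "real^'n^'n"
    using norm_orthogonal_mult_left[OF that, of "mat 1"] by simp
  then have "bounded {Q :: real^'n^'n. orthogonal_matrix Q}"
    by (auto intro!: boundedI)
  moreover have "closed {Q :: real^'n^'n. orthogonal_matrix Q}"
    unfolding orthogonal_matrix
    by (intro closed_Collect_eq continuous_on_const continuous_on_id mm.continuous_on continuous_on_transpose)
  ultimately show ?thesis
    by (simp add: compact_eq_bounded_closed)
qed

lemma continuous_on_det: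
  fixes f :: "'a::topological_space \<Rightarrow> real^'n^'n"
  assumes "continuous_on S f"
  shows "continuous_on S (\<lambda>x. det (f x))"
  unfolding det_def
  by (intro continuous_on_sum continuous_on_mult continuous_on_const continuous_on_prod
        continuous_on_component assms)

lemma SO_group_mult:
  assumes "P \<in> SO_group" "Q \<in> SO_group"
  shows "P ** Q \<in> SO_group"
  using assms by (simp add: SO_group_def orthogonal_matrix_mul det_mul)

lemma SO_group_transpose: "transpose Q \<in> SO_group \<longleftrightarrow> Q \<in> SO_group"
  by (simp add: SO_group_def)

lemma closed_SO_group: "closed (SO_group :: (real^'n^'n) set)"
proof -
  have "closed {Q :: real^'n^'n. det Q = 1}"
    by (intro closed_Collect_eq continuous_on_det continuous_on_const continuous_on_id)
  then have "closed ({Q. orthogonal_matrix Q} \<inter> {Q :: real^'n^'n. det Q = 1})"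
    by (rule closed_Int[OF compact_imp_closed[OF orthogonal_matrix_compact]])
  then show ?thesis
    by (simp add: SO_group_def Collect_conj_eq)
qed

lemma skew_mat_nth:
  "skew_mat p q $ x $ y = (if x = p \<and> y = q then 1 else 0) - (if x = q \<and> y = p then 1 else 0)"
  by (simp add: skew_mat_def unit_mat_def)

lemma so_algebra_iff: "Z \<in> so_algebra \<longleftrightarrow> (\<forall>x y. Z $ y $ x = - (Z $ x $ y))"
proof -
  have "Z \<in> so_algebra \<longleftrightarrow> (\<forall>x y. transpose Z $ x $ y = (- Z) $ x $ y)"
    unfolding so_algebra_def mem_Collect_eq vec_eq_iff ..
  moreover have "transpose Z $ x $ y = Z $ y $ x" "(- Z) $ x $ y = - (Z $ x $ y)" for x y
    by (simp_all add: transpose_def)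
  ultimately show ?thesis
    by presburger
qed

lemma so_algebra_skew_mat: "skew_mat p q \<in> so_algebra"
proof -
  have "skew_mat p q $ y $ x = - (skew_mat p q $ x $ y)" for x y
    unfolding skew_mat_nth by argo
  then show ?thesis
    unfolding so_algebra_iff by blast
qed

lemma matrix_unit_mat_sum:
  fixes M :: "real^'n^'n"
  shows "M = (\<Sum>a\<in>UNIV. \<Sum>b\<in>UNIV. M$a$b *\<^sub>R unit_mat a b)"
proof -
  have "(\<Sum>b\<in>UNIV. (M$a$b *\<^sub>R unit_mat a b) $ x $ y) = (if a = x then M$a$y else 0)" for a x y
  proof -
    have "(\<Sum>b\<in>UNIV. (M$a$b *\<^sub>R unit_mat a b) $ x $ y)
        = (\<Sum>b\<in>UNIV. if b = y then (if a = x then M$a$b else 0) else 0)"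
      by (intro sum.cong) (auto simp: unit_mat_def)
    then show ?thesis by simp
  qed
  then show ?thesis by (simp add: vec_eq_iff)
qed

lemma has_vector_derivative_matrixI:
  fixes X :: "real \<Rightarrow> real^'n^'n"
  assumes "\<And>a b. ((\<lambda>t. X t $ a $ b) has_real_derivative D $ a $ b) F"
  shows "(X has_vector_derivative D) F"
proof -
  have "((\<lambda>t. \<Sum>a\<in>UNIV. \<Sum>b\<in>UNIV. X t $ a $ b *\<^sub>R unit_mat a b) has_vector_derivative
      (\<Sum>a\<in>UNIV. \<Sum>b\<in>UNIV. D $ a $ b *\<^sub>R unit_mat a b)) F"
    by (intro has_vector_derivative_sum bounded_linear.has_vector_derivative[OF bounded_linear_scaleR_left]
          assms[unfolded has_real_derivative_iff_has_vector_derivative])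
  then show ?thesis
    by (simp flip: matrix_unit_mat_sum)
qed

section \<open>Solutions of the control system and the matrix exponential\<close>

primrec matrix_power :: "real^'n^'n \<Rightarrow> nat \<Rightarrow> real^'n^'n" where
  "matrix_power Z 0 = mat 1"
| "matrix_power Z (Suc k) = Z ** matrix_power Z k"

text \<open>The time \<open>t\<close> is kept separate from \<open>Z\<close>, so that every entry is a real power series in \<open>t\<close> and can
  be differentiated termwise.\<close>
definition matrix_exp :: "real \<Rightarrow> real^'n^'n \<Rightarrow> real^'n^'n" where
  "matrix_exp t Z = (\<chi> a b. \<Sum>k. matrix_power Z k $ a $ b / fact k * t ^ k)"

lemma norm_matrix_power_le: "norm (matrix_power Z k) \<le> norm Z ^ k * norm (mat 1 :: real^'n^'n)"
  for Z :: "real^'n^'n"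
proof (induction k)
  case (Suc k)
  have "norm (matrix_power Z (Suc k)) \<le> norm Z * norm (matrix_power Z k)"
    by (simp add: norm_matrix_mult_le)
  also have "\<dots> \<le> norm Z * (norm Z ^ k * norm (mat 1 :: real^'n^'n))"
    using Suc by (intro mult_left_mono) auto
  finally show ?case by (simp add: mult.assoc)
qed simp

lemma summable_matrix_exp_entry:
  fixes Z :: "real^'n^'n"
  shows "summable (\<lambda>k. matrix_power Z k $ a $ b / fact k * t ^ k)"
proof (rule summable_comparison_test')
  show "summable (\<lambda>k. norm (mat 1 :: real^'n^'n) * (inverse (fact k) * (norm Z * \<bar>t\<bar>) ^ k))"
    by (intro summable_mult summable_exp)
  fix k :: nat
  have "\<bar>matrix_power Z k $ a $ b\<bar> \<le> norm (matrix_power Z k)"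
    unfolding real_norm_def[symmetric]
    by (rule order_trans[OF Finite_Cartesian_Product.norm_nth_le Finite_Cartesian_Product.norm_nth_le])
  also have "\<dots> \<le> norm Z ^ k * norm (mat 1 :: real^'n^'n)"
    by (rule norm_matrix_power_le)
  finally have "\<bar>matrix_power Z k $ a $ b\<bar> * (\<bar>t\<bar> ^ k / fact k)
      \<le> norm Z ^ k * norm (mat 1 :: real^'n^'n) * (\<bar>t\<bar> ^ k / fact k)"
    by (intro mult_right_mono) auto
  then show "norm (matrix_power Z k $ a $ b / fact k * t ^ k)
      \<le> norm (mat 1 :: real^'n^'n) * (inverse (fact k) * (norm Z * \<bar>t\<bar>) ^ k)"
    by (simp add: abs_mult power_abs power_mult_distrib field_simps)
qed

lemma matrix_exp_0: "matrix_exp 0 Z = mat 1" for Z :: "real^'n^'n"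
proof -
  have "matrix_exp 0 Z $ a $ b = (mat 1 :: real^'n^'n) $ a $ b" for a b
    by (simp only: matrix_exp_def vec_lambda_beta powser_zero) simp
  then show ?thesis
    by (simp add: vec_eq_iff)
qed

lemma matrix_exp_has_vector_derivative:
  "((\<lambda>t. matrix_exp t Z) has_vector_derivative Z ** matrix_exp t Z) (at t within S)"
proof (rule has_vector_derivative_matrixI)
  fix a b
  let ?c = "\<lambda>a b k. matrix_power Z k $ a $ b / fact k"
  have d: "diffs (?c a b) k = (\<Sum>l\<in>UNIV. Z $ a $ l * ?c l b k)" for k
  proof -
    have "diffs (?c a b) k = matrix_power Z (Suc k) $ a $ b / fact k"
      unfolding diffs_def fact_Suc by (simp add: divide_simps del: of_nat_Suc matrix_power.simps)
    then show ?thesis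
      by (simp add: matrix_matrix_mult_def sum_divide_distrib)
  qed
  have "((\<lambda>t. \<Sum>k. ?c a b k * t ^ k) has_field_derivative (\<Sum>k. diffs (?c a b) k * t ^ k)) (at t)"
    by (rule termdiffs_strong_converges_everywhere[OF summable_matrix_exp_entry])
  moreover have "(\<Sum>k. diffs (?c a b) k * t ^ k) = (\<Sum>l\<in>UNIV. Z $ a $ l * (\<Sum>k. ?c l b k * t ^ k))"
  proof -
    have "(\<Sum>k. diffs (?c a b) k * t ^ k) = (\<Sum>k. \<Sum>l\<in>UNIV. Z $ a $ l * (?c l b k * t ^ k))"
      by (simp add: d sum_distrib_right mult.assoc)
    also have "\<dots> = (\<Sum>l\<in>UNIV. \<Sum>k. Z $ a $ l * (?c l b k * t ^ k))"
      by (intro suminf_sum summable_mult summable_matrix_exp_entry)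
    also have "\<dots> = (\<Sum>l\<in>UNIV. Z $ a $ l * (\<Sum>k. ?c l b k * t ^ k))"
      by (intro sum.cong refl suminf_mult summable_matrix_exp_entry)
    finally show ?thesis .
  qed
  ultimately show "((\<lambda>t. matrix_exp t Z $ a $ b) has_real_derivative (Z ** matrix_exp t Z) $ a $ b) (at t within S)"
    by (auto simp: matrix_exp_def matrix_matrix_mult_def intro: has_field_derivative_at_within)
qed

text \<open>The derivative of \<open>X\<^sup>T Y\<close> is \<open>X\<^sup>T (Z\<^sup>T + Z) Y = 0\<close>. With \<open>X = Y\<close> this says that solutions stay
  orthogonal; it also shows that a solution that starts at zero stays zero.\<close>
lemma skew_flow_transpose_mult_constant:
  fixes X Y :: "real \<Rightarrow> real^'k^'n" and Z :: "real \<Rightarrow> real^'n^'n"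
  assumes "finite S" "continuous_on {0..T} X" "continuous_on {0..T} Y"
    and skew: "\<And>t. transpose (Z t) = - Z t"
    and dX: "\<And>t. t \<in> {0..T} - S \<Longrightarrow> (X has_vector_derivative Z t ** X t) (at t within {0..T})"
    and dY: "\<And>t. t \<in> {0..T} - S \<Longrightarrow> (Y has_vector_derivative Z t ** Y t) (at t within {0..T})"
    and t: "t \<in> {0..T}"
  shows "transpose (X t) ** Y t = transpose (X 0) ** Y 0"
proof (rule has_derivative_zero_unique_strong_interval[OF \<open>finite S\<close> _ _ _ t])
  show "continuous_on {0..T} (\<lambda>t. transpose (X t) ** Y t)"
    by (intro mm.continuous_on continuous_on_transpose assms)
  fix s assume s: "s \<in> {0..T} - S"
  have "((\<lambda>t. transpose (X t) ** Y t) has_vector_derivative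
     transpose (X s) ** (Z s ** Y s) + transpose (Z s ** X s) ** Y s) (at s within {0..T})"
    by (intro mm.has_vector_derivative has_vector_derivative_transpose dX dY s)
  moreover have "transpose (X s) ** (Z s ** Y s) + transpose (Z s ** X s) ** Y s = 0"
    by (simp add: matrix_transpose_mul skew mm.minus_left mm.minus_right matrix_mul_assoc)
  ultimately show "((\<lambda>t. transpose (X t) ** Y t) has_derivative (\<lambda>h. 0)) (at s within {0..T})"
    by (simp add: has_vector_derivative_def)
qed simp

abbreviation control_field ::
  "real^'n^'n \<Rightarrow> nat \<Rightarrow> (nat \<Rightarrow> 'n) \<Rightarrow> (nat \<Rightarrow> 'n) \<Rightarrow> (nat \<Rightarrow> real) \<Rightarrow> real^'n^'n" where
  "control_field A m i j c \<equiv> A + (\<Sum>k=1..m. c k *\<^sub>R skew_mat (i k) (j k))"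

lemma control_field_skew:
  assumes "A \<in> so_algebra"
  shows "transpose (control_field A m i j c) = - control_field A m i j c"
proof -
  have "transpose (skew_mat p q) = - skew_mat p q" for p q :: 'a
    using so_algebra_skew_mat[of p q] by (simp add: so_algebra_def)
  then have "transpose (\<Sum>k=1..m. c k *\<^sub>R skew_mat (i k) (j k)) = - (\<Sum>k=1..m. c k *\<^sub>R skew_mat (i k) (j k))"
    by (simp add: linear_sum[OF bounded_linear.linear[OF bounded_linear_transpose]] transpose_scalar sum_negf)
  then show ?thesis
    using assms by (simp add: transpose_add so_algebra_def)
qed

lemma is_solutionD:
  assumes "is_solution A m i j u T X"
  shows "continuous_on {0..T} X" "X 0 = mat 1"
  using assms by (simp_all add: is_solution_def)

lemma is_solutionE:
  assumes "is_solution A m i j u T X"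
  obtains S where "finite S" "\<And>t. t \<in> {0..T} - S \<Longrightarrow>
       (X has_vector_derivative control_field A m i j (\<lambda>k. u k t) ** X t) (at t within {0..T})"
proof -
  have "\<exists>S. finite S \<and> (\<forall>t\<in>{0..T} - S.
       (X has_vector_derivative control_field A m i j (\<lambda>k. u k t) ** X t) (at t within {0..T}))"
    using assms by (simp add: is_solution_def mm.add_left)
  then obtain S where S: "finite S" and d: "\<forall>t\<in>{0..T} - S.
       (X has_vector_derivative control_field A m i j (\<lambda>k. u k t) ** X t) (at t within {0..T})"
    by (elim exE conjE)
  show thesis
    by (rule that[OF S]) (rule bspec[OF d])
qed

lemma solution_orthogonal:
  assumes "is_solution A m i j u T X" "A \<in> so_algebra" "t \<in> {0..T}"
  shows "orthogonal_matrix (X t)"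
proof -
  obtain S where "finite S" "\<And>t. t \<in> {0..T} - S \<Longrightarrow>
       (X has_vector_derivative control_field A m i j (\<lambda>k. u k t) ** X t) (at t within {0..T})"
    by (rule is_solutionE[OF assms(1)], rule that)
  then have "transpose (X t) ** X t = transpose (X 0) ** X 0"
    using assms is_solutionD[OF assms(1)] control_field_skew
    by (intro skew_flow_transpose_mult_constant[of S T X X "\<lambda>t. control_field A m i j (\<lambda>k. u k t)"]) auto
  then show ?thesis
    using is_solutionD(2)[OF assms(1)] by (simp add: orthogonal_matrix)
qed

text \<open>The determinant is continuous along a solution, takes only the values \<open>1\<close> and \<open>-1\<close>, and starts at \<open>1\<close>.\<close>
lemma reachable_subset_SO:
  assumes "A \<in> so_algebra"
  shows "reachable A m i j \<subseteq> SO_group"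
proof
  fix Q assume "Q \<in> reachable A m i j"
  then obtain T X u where T: "0 \<le> T" and X: "is_solution A m i j u T X" and Q: "Q = X T"
    by (auto simp: reachable_def reachable_at_def)
  have orth: "orthogonal_matrix (X t)" if "t \<in> {0..T}" for t
    using solution_orthogonal[OF X assms that] .
  have "det (X T) \<noteq> -1"
  proof
    assume "det (X T) = -1"
    then have "\<exists>t\<ge>0. t \<le> T \<and> det (X t) = 0"
      using T is_solutionD(1,2)[OF X] by (intro IVT2') (auto intro: continuous_on_det)
    then show False
      using orth det_orthogonal_matrix by force
  qed
  then show "Q \<in> SO_group"
    using orth[of T] T det_orthogonal_matrix[of Q] by (auto simp: SO_group_def Q)
qed

lemma piecewise_constant_on_append:
  assumes "piecewise_constant_on u 0 T" "piecewise_constant_on v 0 T'"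
  shows "piecewise_constant_on (\<lambda>t. if t < T then u t else v (t - T)) 0 (T + T')"
proof -
  obtain S S' where S: "finite S" "\<And>s t. {s<..<t} \<subseteq> {0..T} - S \<Longrightarrow> u constant_on {s<..<t}"
    and S': "finite S'" "\<And>s t. {s<..<t} \<subseteq> {0..T'} - S' \<Longrightarrow> v constant_on {s<..<t}"
    using assms unfolding piecewise_constant_on_def by blast
  show ?thesis
    unfolding piecewise_constant_on_def
  proof (intro exI conjI allI impI)
    \<comment> \<open>The switching time \<open>T\<close> is exceptional, so no admissible interval crosses it.\<close>
    show "finite (S \<union> {T} \<union> (\<lambda>t. t + T) ` S')"
      using S S' by simp
    fix s t assume st: "{s<..<t} \<subseteq> {0..T + T'} - (S \<union> {T} \<union> (\<lambda>t. t + T) ` S')"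
    consider "t \<le> s" | "t \<le> T" | "T \<le> s" | "s < T" "T < t" by linarith
    then show "(\<lambda>t. if t < T then u t else v (t - T)) constant_on {s<..<t}"
    proof cases
      case 2
      then have "{s<..<t} \<subseteq> {0..T} - S" using st by fastforce
      from S(2)[OF this] 2 show ?thesis by (auto simp: constant_on_def)
    next
      case 3
      have "{s - T<..<t - T} \<subseteq> {0..T'} - S'"
      proof
        fix x assume "x \<in> {s - T<..<t - T}"
        then have "x + T \<in> {s<..<t}" by auto
        with st have "x + T \<in> {0..T + T'} - (S \<union> {T} \<union> (\<lambda>t. t + T) ` S')" by blast
        then show "x \<in> {0..T'} - S'" using 3 \<open>x + T \<in> {s<..<t}\<close> by auto
      qed
      from S'(2)[OF this] obtain c where "\<And>x. x \<in> {s - T<..<t - T} \<Longrightarrow> v x = c"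
        by (auto simp: constant_on_def)
      then show ?thesis using 3 by (auto simp: constant_on_def)
    next
      case 4
      then have "T \<in> {s<..<t}" by simp
      then show ?thesis using st by blast
    qed (auto simp: constant_on_def)
  qed
qed

text \<open>The system is right invariant: a solution multiplied from the right by a fixed matrix again satisfies
  the differential equation, so two solutions can be run one after the other.\<close>
lemma is_solution_append:
  assumes X: "is_solution A m i j u T X" and Y: "is_solution A m i j v T' Y"
    and T: "0 \<le> T" "0 \<le> T'"
  shows "is_solution A m i j (\<lambda>k t. if t < T then u k t else v k (t - T)) (T + T')
           (\<lambda>t. if t \<le> T then X t else Y (t - T) ** X T)"
    (is "is_solution A m i j ?w _ ?Z")
proof -
  obtain S where S: "finite S" "\<And>t. t \<in> {0..T} - S \<Longrightarrow>
       (X has_vector_derivative control_field A m i j (\<lambda>k. u k t) ** X t) (at t within {0..T})"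
    by (rule is_solutionE[OF X], rule that)
  obtain S' where S': "finite S'" "\<And>t. t \<in> {0..T'} - S' \<Longrightarrow>
       (Y has_vector_derivative control_field A m i j (\<lambda>k. v k t) ** Y t) (at t within {0..T'})"
    by (rule is_solutionE[OF Y], rule that)
  have "continuous_on ({0..T} \<union> {T..T + T'}) ?Z"
  proof (intro continuous_on_If mm.continuous_on continuous_on_const closed_real_atLeastAtMost)
    show "continuous_on {0..T} X" by (rule is_solutionD(1)[OF X])
    have "continuous_on {0..T'} Y" by (rule is_solutionD(1)[OF Y])
    then show "continuous_on {T..T + T'} (\<lambda>t. Y (t - T))"
      by (rule continuous_on_compose2) (auto intro!: continuous_on_diff continuous_on_id continuous_on_const)
  qed (use is_solutionD(2)[OF Y] in auto)
  moreover have "{0..T} \<union> {T..T + T'} = {0..T + T'}"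
    using T by auto
  moreover have "?Z 0 = mat 1"
    using T is_solutionD(2)[OF X] by simp
  moreover have "(?Z has_vector_derivative control_field A m i j (\<lambda>k. ?w k t) ** ?Z t) (at t within {0..T + T'})"
    if t: "t \<in> {0..T + T'} - (S \<union> (\<lambda>t. t + T) ` S' \<union> {0, T, T + T'})" for t
  proof (cases "t < T")
    case True
    then have "(X has_vector_derivative control_field A m i j (\<lambda>k. u k t) ** X t) (at t within {0..T})"
      using t by (intro S(2)) auto
    moreover have "at t within {0..T} = at t"
      using t True by (intro at_within_interior) auto
    ultimately have "(?Z has_vector_derivative control_field A m i j (\<lambda>k. u k t) ** X t) (at t)"
      using True t by (auto intro: has_vector_derivative_transform_within_open[of X _ t "{..<T}"])
    then show ?thesis
      using True by (auto intro: has_vector_derivative_at_within)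
  next
    case False
    with t have tT: "T < t" "t < T + T'" by auto
    have "(Y has_vector_derivative control_field A m i j (\<lambda>k. v k (t - T)) ** Y (t - T)) (at (t - T) within {0..T'})"
      using t tT by (intro S'(2)) (auto simp: image_iff)
    moreover have "at (t - T) within {0..T'} = at (t - T)"
      using tT by (intro at_within_interior) auto
    ultimately have dY: "(Y has_vector_derivative control_field A m i j (\<lambda>k. v k (t - T)) ** Y (t - T)) (at (t - T))"
      by simp
    have "((\<lambda>t. t - T) has_vector_derivative 1) (at t)"
      by (auto intro!: derivative_eq_intros)
    from vector_diff_chain_at[OF this dY]
    have "((\<lambda>t. Y (t - T)) has_vector_derivative control_field A m i j (\<lambda>k. v k (t - T)) ** Y (t - T)) (at t)"
      by (simp add: o_def)
    then have "((\<lambda>t. Y (t - T) ** X T) has_vector_derivative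
        (control_field A m i j (\<lambda>k. v k (t - T)) ** Y (t - T)) ** X T) (at t)"
      by (rule bounded_linear.has_vector_derivative[OF mm.bounded_linear_left])
    then have "(?Z has_vector_derivative
        (control_field A m i j (\<lambda>k. v k (t - T)) ** Y (t - T)) ** X T) (at t)"
      using tT by (auto intro: has_vector_derivative_transform_within_open[of "\<lambda>t. Y (t - T) ** X T" _ t "{T<..}"])
    then show ?thesis
      using tT by (auto intro: has_vector_derivative_at_within simp: matrix_mul_assoc)
  qed
  ultimately show ?thesis
    unfolding is_solution_def mm.add_left[symmetric]
    by (intro conjI exI[of _ "S \<union> (\<lambda>t. t + T) ` S' \<union> {0, T, T + T'}"]) (use S(1) S'(1) in simp_all)
qed

lemma reachableI:
  assumes "0 \<le> T" "\<And>k. k \<in> {1..m} \<Longrightarrow> piecewise_constant_on (u k) 0 T" "is_solution A m i j u T X"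
  shows "X T \<in> reachable A m i j"
proof -
  have "X T \<in> reachable_at A m i j T"
    unfolding reachable_at_def mem_Collect_eq
    by (intro exI[of _ X] exI[of _ u] conjI ballI refl assms)
  then show ?thesis
    using assms(1) by (auto simp: reachable_def)
qed

lemma reachable_mult:
  assumes "P \<in> reachable A m i j" "Q \<in> reachable A m i j"
  shows "P ** Q \<in> reachable A m i j"
proof -
  obtain T X u T' Y v where X: "0 \<le> T" "is_solution A m i j u T X" "Q = X T"
      "\<And>k. k \<in> {1..m} \<Longrightarrow> piecewise_constant_on (u k) 0 T"
    and Y: "0 \<le> T'" "is_solution A m i j v T' Y" "P = Y T'"
      "\<And>k. k \<in> {1..m} \<Longrightarrow> piecewise_constant_on (v k) 0 T'"
    using assms unfolding reachable_def reachable_at_def by fastforce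
  let ?Z = "\<lambda>t. if t \<le> T then X t else Y (t - T) ** X T"
  have "P ** Q = ?Z (T + T')"
    using X Y is_solutionD(2)[OF Y(2)] by auto
  moreover have "?Z (T + T') \<in> reachable A m i j"
    by (rule reachableI[OF _ _ is_solution_append[OF X(2) Y(2) X(1) Y(1)]])
       (use X(1) Y(1) in simp, rule piecewise_constant_on_append[OF X(4) Y(4)])
  ultimately show ?thesis
    by simp
qed

lemma matrix_exp_control_field_reachable:
  assumes "0 \<le> t"
  shows "matrix_exp t (control_field A m i j c) \<in> reachable A m i j"
proof -
  have "is_solution A m i j (\<lambda>k _. c k) t (\<lambda>s. matrix_exp s (control_field A m i j c))"
    unfolding is_solution_def mm.add_left[symmetric]
    by (intro conjI exI[of _ "{}"] ballI continuous_on_vector_derivative[OF matrix_exp_has_vector_derivative])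
       (auto simp: matrix_exp_0 intro: matrix_exp_has_vector_derivative)
  moreover have "piecewise_constant_on (\<lambda>_. c k) 0 t" for k
    by (auto simp: piecewise_constant_on_def constant_on_def)
  ultimately show ?thesis
    using assms by (intro reachableI[of t m "\<lambda>k _. c k" A i j "\<lambda>s. matrix_exp s (control_field A m i j c)"])
qed

lemma mat_1_reachable: "mat 1 \<in> reachable A m i j"
  using matrix_exp_control_field_reachable[where t = 0 and c = "\<lambda>_. 0"] by (simp add: matrix_exp_0)

lemma skew_flow_orthogonal:
  fixes X :: "real \<Rightarrow> real^'n^'n"
  assumes "Z \<in> so_algebra" "X 0 = mat 1" "0 \<le> t"
    and "\<And>t. (X has_vector_derivative Z ** X t) (at t)"
  shows "orthogonal_matrix (X t)"
proof -
  have "continuous_on {0..t} X"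
    using assms(4) by (intro continuous_on_vector_derivative[of _ X]) (auto intro: has_vector_derivative_at_within)
  then have "transpose (X t) ** X t = transpose (X 0) ** X 0"
    using assms by (intro skew_flow_transpose_mult_constant[of "{}" t X X "\<lambda>_. Z"])
      (auto simp: so_algebra_def intro: has_vector_derivative_at_within)
  then show ?thesis
    using assms by (simp add: orthogonal_matrix)
qed

text \<open>Two skew flows drift apart at most linearly in the difference of their generators, since
  \<open>X\<^sup>T Y\<close> has the derivative \<open>X\<^sup>T (W - Z) Y\<close>, whose norm is that of \<open>W - Z\<close> because
  \<open>X\<close> and \<open>Y\<close> are orthogonal.\<close>
lemma skew_flow_diff_le:
  fixes X Y :: "real \<Rightarrow> real^'n^'n"
  assumes Z: "Z \<in> so_algebra" "X 0 = mat 1" "\<And>t. (X has_vector_derivative Z ** X t) (at t)"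
    and W: "W \<in> so_algebra" "Y 0 = mat 1" "\<And>t. (Y has_vector_derivative W ** Y t) (at t)"
    and t: "0 \<le> t"
  shows "norm (X t - Y t) \<le> norm (Z - W) * t"
proof (cases "t = 0")
  case False
  have oX: "orthogonal_matrix (X s)" and oY: "orthogonal_matrix (Y s)" if "0 \<le> s" for s
    using skew_flow_orthogonal[OF Z(1,2) that Z(3)] skew_flow_orthogonal[OF W(1,2) that W(3)] .
  let ?D = "\<lambda>t. transpose (X t) ** Y t"
  have d: "(?D has_vector_derivative transpose (X s) ** ((W - Z) ** Y s)) (at s within S)" for s S
  proof -
    have "(?D has_vector_derivative transpose (X s) ** (W ** Y s) + transpose (Z ** X s) ** Y s) (at s within S)"
      by (intro mm.has_vector_derivative has_vector_derivative_transpose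
            has_vector_derivative_at_within[OF Z(3)] has_vector_derivative_at_within[OF W(3)])
    moreover have "transpose (Z ** X s) = - (transpose (X s) ** Z)"
      using Z(1) by (simp add: matrix_transpose_mul so_algebra_def mm.minus_right)
    ultimately show ?thesis
      by (simp add: mm.diff_left mm.diff_right mm.minus_left matrix_mul_assoc)
  qed
  have "norm (?D t - ?D 0) \<le> norm (Z - W) * t - norm (Z - W) * 0"
  proof (rule differentiable_bound_general)
    show "continuous_on {0..t} ?D"
      by (rule continuous_on_vector_derivative[OF d])
    show "0 < t" using False t by simp
    show "((\<lambda>t. norm (Z - W) * t) has_vector_derivative norm (Z - W)) (at s)" for s
      by (auto intro!: derivative_eq_intros)
    show "norm (transpose (X s) ** ((W - Z) ** Y s)) \<le> norm (Z - W)" if "0 < s" for s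
      using that oX[of s] oY[of s]
      by (simp add: norm_orthogonal_mult_left norm_orthogonal_mult_right norm_minus_commute)
  qed (auto intro!: continuous_on_mult continuous_on_const continuous_on_id d)
  moreover have "norm (X t - Y t) = norm (transpose (X t) ** (X t - Y t))"
    using oX[OF t] by (simp add: norm_orthogonal_mult_left)
  moreover have "transpose (X t) ** (X t - Y t) = - (?D t - ?D 0)"
    using oX[OF t] Z(2) W(2) by (simp add: mm.diff_right orthogonal_matrix)
  ultimately show ?thesis
    by (simp add: norm_minus_commute)
qed (use Z(2) W(2) in simp)

section \<open>Plane rotations\<close>

lemma unit_mat_mult: "unit_mat a b ** unit_mat c d = (if b = c then unit_mat a d else 0)"
proof -
  have "(unit_mat a b ** unit_mat c d) $ x $ y = (if b = c then unit_mat a d else 0) $ x $ y" for x y :: 'a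
  proof -
    have "(unit_mat a b ** unit_mat c d) $ x $ y
        = (\<Sum>k\<in>UNIV. if k = b then if x = a \<and> b = c \<and> y = d then 1 else 0 else 0)"
      unfolding matrix_matrix_mult_def unit_mat_def vec_lambda_beta by (intro sum.cong refl) auto
    then show ?thesis
      by (simp add: unit_mat_def)
  qed
  then show ?thesis
    by (simp add: vec_eq_iff)
qed

lemma transpose_unit_mat: "transpose (unit_mat a b) = unit_mat b a"
  by (auto simp: transpose_def unit_mat_def vec_eq_iff)

lemma skew_mat_swap: "skew_mat q p = - skew_mat p q"
  by (simp add: skew_mat_def)

lemma transpose_skew_mat: "transpose (skew_mat p q) = - skew_mat p q"
  by (simp add: skew_mat_def transpose_diff transpose_unit_mat)

lemma skew_mat_same: "skew_mat p p = 0"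
  by (simp add: skew_mat_def)

definition plane_rotation :: "'n::finite \<Rightarrow> 'n \<Rightarrow> real \<Rightarrow> real^'n^'n" where
  "plane_rotation p q t = mat 1 + sin t *\<^sub>R skew_mat p q + (cos t - 1) *\<^sub>R (unit_mat p p + unit_mat q q)"

lemma plane_rotation_0: "plane_rotation p q 0 = mat 1"
  by (simp add: plane_rotation_def)

lemma plane_rotation_swap: "plane_rotation q p t = plane_rotation p q (- t)"
  by (simp add: plane_rotation_def skew_mat_swap[of q p] add.commute)

lemma transpose_plane_rotation: "transpose (plane_rotation p q t) = plane_rotation p q (- t)"
  by (simp add: plane_rotation_def transpose_add transpose_scalar transpose_unit_mat transpose_skew_mat)

lemma plane_rotation_nth:
  assumes "p \<noteq> q"
  shows "plane_rotation p q t $ x $ y =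
    (if x = y then if x = p \<or> x = q then cos t else 1
     else if x = p \<and> y = q then sin t else if x = q \<and> y = p then - sin t else 0)"
  using assms by (auto simp: plane_rotation_def skew_mat_def unit_mat_def mat_def)

text \<open>In the coordinate plane of \<open>p\<close> and \<open>q\<close>, \<open>skew_mat p q\<close> acts as the imaginary unit and
  \<open>unit_mat p p + unit_mat q q\<close> as the projection onto the plane.\<close>
lemma skew_mat_plane_products:
  assumes "p \<noteq> q"
  shows "skew_mat p q ** skew_mat p q = - (unit_mat p p + unit_mat q q)"
    "skew_mat p q ** (unit_mat p p + unit_mat q q) = skew_mat p q"
    "(unit_mat p p + unit_mat q q) ** skew_mat p q = skew_mat p q"
    "(unit_mat p p + unit_mat q q) ** (unit_mat p p + unit_mat q q) = unit_mat p p + unit_mat q q"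
  using assms by (auto simp: skew_mat_def mm.add_left mm.add_right mm.diff_left mm.diff_right unit_mat_mult)

lemma plane_rotation_add:
  fixes p q :: "'n::finite"
  assumes "p \<noteq> q"
  shows "plane_rotation p q s ** plane_rotation p q t = plane_rotation p q (s + t)"
proof -
  have 1: "(mat 1 + a *\<^sub>R B + b *\<^sub>R N) ** (mat 1 + c *\<^sub>R B + d *\<^sub>R N)
     = mat 1 + (a + c + a * d + b * c) *\<^sub>R B + (b + d + b * d - a * c) *\<^sub>R N"
    if "B ** B = - N" "B ** N = B" "N ** B = B" "N ** N = N" for a b c d and B N :: "real^'n^'n"
    by (simp add: that mm.add_left mm.add_right mm.scaleR_left mm.scaleR_right algebra_simps)
  show ?thesis
    unfolding plane_rotation_def 1[OF skew_mat_plane_products(1-4)[OF assms]]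
    by (simp add: sin_add cos_add algebra_simps)
qed

lemma orthogonal_plane_rotation:
  assumes "p \<noteq> q"
  shows "orthogonal_matrix (plane_rotation p q t)"
  by (simp add: orthogonal_matrix transpose_plane_rotation plane_rotation_add[OF assms] plane_rotation_0)

text \<open>The determinant is nonnegative because a rotation is the square of the rotation by half the angle.\<close>
lemma plane_rotation_in_SO_group:
  assumes "p \<noteq> q"
  shows "plane_rotation p q t \<in> SO_group"
proof -
  have "det (plane_rotation p q t) = (det (plane_rotation p q (t / 2)))\<^sup>2"
    using plane_rotation_add[OF assms, of "t / 2" "t / 2"] by (simp add: power2_eq_square flip: det_mul)
  then have "det (plane_rotation p q t) \<ge> 0"
    by simp
  then show ?thesis
    using det_orthogonal_matrix[OF orthogonal_plane_rotation[OF assms, of t]]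
    by (auto simp: SO_group_def orthogonal_plane_rotation[OF assms])
qed

lemma plane_rotation_has_vector_derivative:
  assumes "p \<noteq> q"
  shows "(plane_rotation p q has_vector_derivative skew_mat p q ** plane_rotation p q t) (at t within S)"
proof -
  let ?B = "skew_mat p q" and ?N = "unit_mat p p + unit_mat q q"
  have "((\<lambda>t. mat 1 + sin t *\<^sub>R ?B + (cos t - 1) *\<^sub>R ?N) has_vector_derivative
       cos t *\<^sub>R ?B + (- sin t) *\<^sub>R ?N) (at t within S)"
    by (auto intro!: derivative_eq_intros simp: has_real_derivative_iff_has_vector_derivative[symmetric])
  moreover have "?B ** plane_rotation p q t = cos t *\<^sub>R ?B + (- sin t) *\<^sub>R ?N"
    unfolding plane_rotation_def mm.add_right[of _ _ "(cos t - 1) *\<^sub>R ?N"] mm.add_right[of _ _ "sin t *\<^sub>R ?B"]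
      mm.scaleR_right skew_mat_plane_products[OF assms] matrix_mul_rid
    by (simp only: scaleR_left_diff_distrib scaleR_one scaleR_minus_left scaleR_minus_right) simp
  ultimately show ?thesis
    by (simp add: plane_rotation_def[abs_def])
qed

section \<open>Necessity of connectedness\<close>

text \<open>With \<open>P\<close> the coordinate projection onto \<open>C\<close>, every control field commutes with \<open>P\<close>. Hence the
  commutator \<open>P X - X P\<close> solves the same linear equation as \<open>X\<close>, starting at zero, and vanishes.\<close>
lemma reachable_block_diagonal:
  fixes A :: "real^'n^'n"
  assumes A: "A \<in> so_algebra" and A0: "\<And>x y. x \<in> C \<Longrightarrow> y \<notin> C \<Longrightarrow> A $ x $ y = 0"
    and ij: "\<And>k. k \<in> {1..m} \<Longrightarrow> i k \<in> C \<longleftrightarrow> j k \<in> C"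
    and Q: "Q \<in> reachable A m i j" and xy: "x \<in> C" "y \<notin> C"
  shows "Q $ x $ y = 0"
proof -
  define P :: "real^'n^'n" where "P = (\<chi> a b. if a = b \<and> a \<in> C then 1 else 0)"
  have PM: "(P ** M) $ a $ b = (if a \<in> C then M $ a $ b else 0)" for M :: "real^'n^'n" and a b
  proof -
    have "(P ** M) $ a $ b = (\<Sum>k\<in>UNIV. if k = a then if a \<in> C then M $ a $ b else 0 else 0)"
      unfolding matrix_matrix_mult_def P_def vec_lambda_beta by (intro sum.cong refl) auto
    then show ?thesis by simp
  qed
  have MP: "(M ** P) $ a $ b = (if b \<in> C then M $ a $ b else 0)" for M :: "real^'n^'n" and a b
  proof -
    have "(M ** P) $ a $ b = (\<Sum>k\<in>UNIV. if k = b then if b \<in> C then M $ a $ b else 0 else 0)"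
      unfolding matrix_matrix_mult_def P_def vec_lambda_beta by (intro sum.cong refl) auto
    then show ?thesis by simp
  qed
  have block: "control_field A m i j c $ a $ b = 0" if "a \<in> C \<longleftrightarrow> b \<notin> C" for c a b
  proof -
    have "A $ a $ b = 0"
    proof -
      have "A $ b $ a = - (A $ a $ b)"
        using A unfolding so_algebra_iff by blast
      then show ?thesis
        using that A0[of a b] A0[of b a] by (cases "a \<in> C") auto
    qed
    moreover have "skew_mat (i k) (j k) $ a $ b = 0" if "k \<in> {1..m}" for k
    proof -
      have "(a = i k \<and> b = j k) = False" "(a = j k \<and> b = i k) = False"
        using ij[OF that] \<open>a \<in> C \<longleftrightarrow> b \<notin> C\<close> by blast+
      then show ?thesis
        by (simp only: skew_mat_nth if_False)
    qed
    ultimately show ?thesis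
      by (simp add: sum_component)
  qed
  have comm: "P ** control_field A m i j c = control_field A m i j c ** P" for c
  proof -
    have "(P ** control_field A m i j c) $ a $ b = (control_field A m i j c ** P) $ a $ b" for a b
      unfolding PM MP using block[of a b c] by auto
    then show ?thesis by (simp add: vec_eq_iff)
  qed
  obtain T X u where T: "0 \<le> T" and X: "is_solution A m i j u T X" and Q: "Q = X T"
    using Q by (auto simp: reachable_def reachable_at_def)
  obtain S where S: "finite S" "\<And>t. t \<in> {0..T} - S \<Longrightarrow>
       (X has_vector_derivative control_field A m i j (\<lambda>k. u k t) ** X t) (at t within {0..T})"
    by (rule is_solutionE[OF X], rule that)
  define Y where "Y = (\<lambda>t. P ** X t - X t ** P)"
  have Y0: "Y 0 = 0"
    by (simp add: Y_def is_solutionD(2)[OF X])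
  have cY: "continuous_on {0..T} Y"
    unfolding Y_def
    by (intro continuous_on_diff mm.continuous_on continuous_on_const is_solutionD(1)[OF X])
  have dY: "(Y has_vector_derivative control_field A m i j (\<lambda>k. u k t) ** Y t) (at t within {0..T})"
    if "t \<in> {0..T} - S" for t
  proof -
    let ?Z = "control_field A m i j (\<lambda>k. u k t)"
    have "(Y has_vector_derivative P ** (?Z ** X t) - (?Z ** X t) ** P) (at t within {0..T})"
      unfolding Y_def
      by (intro has_vector_derivative_diff S(2)[OF that]
          bounded_linear.has_vector_derivative[OF mm.bounded_linear_left]
          bounded_linear.has_vector_derivative[OF mm.bounded_linear_right])
    moreover have "P ** (?Z ** X t) - (?Z ** X t) ** P = ?Z ** Y t"
      unfolding Y_def mm.diff_right matrix_mul_assoc comm ..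
    ultimately show ?thesis by simp
  qed
  have "transpose (Y T) ** Y T = transpose (Y 0) ** Y 0"
    using T by (intro skew_flow_transpose_mult_constant[OF S(1) cY cY control_field_skew[OF A] dY dY]) auto
  then have "inner (Y T) (Y T) = 0"
    by (simp add: inner_matrix_trace Y0 mm.zero_right trace_def)
  then have "(P ** Q) $ x $ y = (Q ** P) $ x $ y"
    by (simp add: Y_def Q)
  then show ?thesis
    using xy by (simp add: PM MP)
qed

text \<open>A quarter turn in the plane of two nodes that are not joined has a nonzero entry between the
  component of the first node and the rest.\<close>
lemma controllable_imp_connected:
  fixes A :: "real^'n^'n"
  assumes A: "A \<in> so_algebra" and con: "controllable A m i j"
  shows "connected_graph (drift_edges A \<union> contr_edges m i j)"
proof (rule ccontr)
  let ?E = "drift_edges A \<union> contr_edges m i j"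
  assume "\<not> connected_graph ?E"
  then obtain x y where xy: "x \<noteq> y" "(x, y) \<notin> joined ?E"
    by (auto simp: connected_graph_def)
  define C where "C = {z. (x, z) \<in> joined ?E}"
  have C: "a \<in> C \<longleftrightarrow> b \<in> C" if "{a, b} \<in> ?E" for a b
  proof -
    have "(a, b) \<in> adjacency ?E" "(b, a) \<in> adjacency ?E"
      using that by (auto simp: adjacency_def insert_commute)
    then show ?thesis
      unfolding C_def joined_def by (auto intro: rtrancl_into_rtrancl)
  qed
  have "x \<in> C" "y \<notin> C"
    using xy by (auto simp: C_def joined_def)
  have "plane_rotation x y (pi / 2) \<in> reachable A m i j"
    using con plane_rotation_in_SO_group[OF xy(1)] by (simp add: controllable_def)
  then have "plane_rotation x y (pi / 2) $ x $ y = 0"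
  proof (rule reachable_block_diagonal[OF A, rotated 2])
    fix a b assume ab: "a \<in> C" "b \<notin> C"
    have "{a, b} \<notin> drift_edges A"
      using C[of a b] ab by blast
    moreover have "A $ a $ b = - (A $ b $ a)"
      using A unfolding so_algebra_iff by blast
    ultimately show "A $ a $ b = 0"
      unfolding drift_edges_def by blast
  next
    show "i k \<in> C \<longleftrightarrow> j k \<in> C" if "k \<in> {1..m}" for k
      using that by (intro C) (auto simp: contr_edges_def)
  qed fact+
  then show False
    using xy(1) by (simp add: plane_rotation_nth)
qed

section \<open>Conjugation of skew-symmetric matrices by rotations\<close>

lemma mult_unit_mat_nth:
  fixes M :: "real^'n^'n"
  shows "(M ** unit_mat a b) $ x $ y = (if y = b then M $ x $ a else 0)"
proof -
  have "(M ** unit_mat a b) $ x $ y = (\<Sum>l\<in>UNIV. if l = a then if y = b then M $ x $ a else 0 else 0)"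
    unfolding matrix_matrix_mult_def unit_mat_def vec_lambda_beta by (intro sum.cong refl) auto
  then show ?thesis by simp
qed

lemma mult_unit_mat_mult_nth:
  fixes M N :: "real^'n^'n"
  shows "(M ** unit_mat a b ** N) $ x $ y = M $ x $ a * N $ b $ y"
proof -
  have "(M ** unit_mat a b ** N) $ x $ y = (\<Sum>k\<in>UNIV. (M ** unit_mat a b) $ x $ k * N $ k $ y)"
    by (simp add: matrix_matrix_mult_def)
  also have "\<dots> = (\<Sum>k\<in>UNIV. if k = b then M $ x $ a * N $ b $ y else 0)"
    unfolding mult_unit_mat_nth by (intro sum.cong refl) auto
  finally show ?thesis by simp
qed

lemma conj_skew_mat_nth:
  fixes Q :: "real^'n^'n"
  shows "(Q ** skew_mat p q ** transpose Q) $ x $ y = Q$x$p * Q$y$q - Q$x$q * Q$y$p"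
  by (simp add: skew_mat_def mm.diff_left mm.diff_right mult_unit_mat_mult_nth transpose_def)

text \<open>A half turn in a coordinate plane is the diagonal matrix with two entries \<open>-1\<close>, so conjugation
  changes the sign of exactly those entries that have exactly one of their two indices in the plane.\<close>
lemma conj_half_turn_nth:
  fixes Z :: "real^'n^'n"
  assumes "a \<noteq> b"
  shows "(plane_rotation a b pi ** Z ** transpose (plane_rotation a b pi)) $ x $ y
    = (if x \<in> {a, b} \<longleftrightarrow> y \<in> {a, b} then Z $ x $ y else - (Z $ x $ y))"
proof -
  let ?s = "\<lambda>x. if x = a \<or> x = b then -1 else 1 :: real"
  have g: "plane_rotation a b pi $ x $ k = (if k = x then ?s x else 0)" for x k
    using assms by (auto simp: plane_rotation_nth)
  have 1: "(plane_rotation a b pi ** Z) $ x $ k = ?s x * Z $ x $ k" for k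
  proof -
    have "(plane_rotation a b pi ** Z) $ x $ k = (\<Sum>l\<in>UNIV. if l = x then ?s x * Z $ x $ k else 0)"
      unfolding matrix_matrix_mult_def vec_lambda_beta g by (intro sum.cong refl) auto
    then show ?thesis by simp
  qed
  have "(plane_rotation a b pi ** Z ** transpose (plane_rotation a b pi)) $ x $ y
      = (\<Sum>k\<in>UNIV. (plane_rotation a b pi ** Z) $ x $ k * plane_rotation a b pi $ y $ k)"
    by (simp add: matrix_matrix_mult_def transpose_def)
  also have "\<dots> = (\<Sum>k\<in>UNIV. if k = y then ?s x * Z $ x $ y * ?s y else 0)"
    unfolding 1 g by (intro sum.cong refl) auto
  finally show ?thesis by auto
qed

lemma skew_mat_sum:
  fixes M :: "real^'n^'n"
  shows "(\<Sum>a\<in>UNIV. \<Sum>b\<in>UNIV. M$a$b *\<^sub>R skew_mat a b) = M - transpose M"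
proof -
  have "(\<Sum>a\<in>UNIV. \<Sum>b\<in>UNIV. M$a$b *\<^sub>R unit_mat b a) = transpose M"
  proof -
    have "(\<Sum>a\<in>UNIV. \<Sum>b\<in>UNIV. M$a$b *\<^sub>R unit_mat b a) = (\<Sum>b\<in>UNIV. \<Sum>a\<in>UNIV. transpose M$b$a *\<^sub>R unit_mat b a)"
      by (subst sum.swap) (simp add: transpose_def)
    then show ?thesis
      by (simp flip: matrix_unit_mat_sum)
  qed
  then show ?thesis
    by (simp add: skew_mat_def scaleR_diff_right sum_subtractf flip: matrix_unit_mat_sum)
qed

section \<open>The tangent cone of a semigroup of rotations\<close>

locale SO_semigroup =
  fixes R :: "(real^'n::finite^'n) set"
  assumes mat_1_mem: "mat 1 \<in> R"
    and mult_mem: "P \<in> R \<Longrightarrow> Q \<in> R \<Longrightarrow> P ** Q \<in> R"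
    and subset_SO_group: "R \<subseteq> SO_group"
begin

text \<open>What matters is that the approximating maps are continuous as well as \<open>R\<close>-valued: mere density of \<open>R\<close>
  would not produce interior points of \<open>R\<close>.\<close>
definition approximable :: "'a::topological_space set \<Rightarrow> ('a \<Rightarrow> real^'n^'n) \<Rightarrow> bool" where
  "approximable K f \<longleftrightarrow>
     (\<forall>e>0. \<exists>g. continuous_on K g \<and> (\<forall>x\<in>K. g x \<in> R \<and> norm (g x - f x) < e))"

lemma closure_subset_SO_group: "closure R \<subseteq> SO_group"
  by (rule closure_minimal[OF subset_SO_group closed_SO_group])

lemma approximable_in_closure:
  assumes "approximable K f" "x \<in> K"
  shows "f x \<in> closure R"
  unfolding closure_approachable dist_norm
  using assms by (auto simp: approximable_def)

lemma approximable_orthogonal: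
  assumes "approximable K f" "x \<in> K"
  shows "orthogonal_matrix (f x)"
  using approximable_in_closure[OF assms] closure_subset_SO_group by (auto simp: SO_group_def)

lemma approximable_if_in_semigroup:
  assumes "continuous_on K f" "\<And>x. x \<in> K \<Longrightarrow> f x \<in> R"
  shows "approximable K f"
  unfolding approximable_def using assms by (auto intro!: exI[of _ f])

lemma approximable_const:
  assumes "Q \<in> closure R"
  shows "approximable K (\<lambda>_. Q)"
  unfolding approximable_def
proof (intro allI impI)
  fix e :: real assume "0 < e"
  then obtain P where "P \<in> R" "norm (P - Q) < e"
    using assms unfolding closure_approachable dist_norm by blast
  then show "\<exists>g. continuous_on K g \<and> (\<forall>x\<in>K. g x \<in> R \<and> norm (g x - Q) < e)"
    by (intro exI[of _ "\<lambda>_. P"]) auto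
qed

lemma approximable_mult:
  assumes f: "approximable K f" and h: "approximable K h"
  shows "approximable K (\<lambda>x. f x ** h x)"
  unfolding approximable_def
proof (intro allI impI)
  fix e :: real assume "0 < e"
  then have "e / 2 > 0" by simp
  then obtain f' h' where f': "continuous_on K f'" "\<And>x. x \<in> K \<Longrightarrow> f' x \<in> R \<and> norm (f' x - f x) < e / 2"
    and h': "continuous_on K h'" "\<And>x. x \<in> K \<Longrightarrow> h' x \<in> R \<and> norm (h' x - h x) < e / 2"
    using f h unfolding approximable_def by blast
  have "norm (f' x ** h' x - f x ** h x) < e" if "x \<in> K" for x
  proof -
    have "orthogonal_matrix (h' x)"
      using h'(2)[OF that] subset_SO_group by (auto simp: SO_group_def)
    then have "norm (f' x ** h' x - f x ** h x) \<le> norm (f' x - f x) + norm (h' x - h x)"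
      by (rule norm_diff_orthogonal_products[OF _ approximable_orthogonal[OF f that]])
    then show ?thesis
      using f'(2)[OF that] h'(2)[OF that] by linarith
  qed
  then show "\<exists>g. continuous_on K g \<and> (\<forall>x\<in>K. g x \<in> R \<and> norm (g x - f x ** h x) < e)"
    using f' h' mult_mem by (intro exI[of _ "\<lambda>x. f' x ** h' x"]) (auto intro: mm.continuous_on)
qed

lemma approximable_compose:
  assumes "approximable K f" "continuous_on K' s" "\<And>x. x \<in> K' \<Longrightarrow> s x \<in> K"
  shows "approximable K' (\<lambda>x. f (s x))"
  unfolding approximable_def
proof (intro allI impI)
  fix e :: real assume "0 < e"
  then obtain g where g: "continuous_on K g" "\<And>x. x \<in> K \<Longrightarrow> g x \<in> R \<and> norm (g x - f x) < e"
    using assms(1) unfolding approximable_def by blast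
  have "continuous_on K' (\<lambda>x. g (s x))"
    by (rule continuous_on_compose2[OF g(1) assms(2)]) (use assms(3) in auto)
  then show "\<exists>g. continuous_on K' g \<and> (\<forall>x\<in>K'. g x \<in> R \<and> norm (g x - f (s x)) < e)"
    using g(2) assms(3) by (intro exI[of _ "\<lambda>x. g (s x)"]) auto
qed

lemma closure_mult:
  assumes "P \<in> closure R" "Q \<in> closure R"
  shows "P ** Q \<in> closure R"
  using approximable_in_closure[OF approximable_mult[OF approximable_const approximable_const], OF assms, of "0::real" UNIV]
  by simp

text \<open>Only the velocity at time zero is prescribed. The curves need not be one-parameter groups, so
  the product of two curves realises the sum of their velocities even when these do not commute.\<close>
definition tangent_cone :: "(real^'n^'n) set" where
  "tangent_cone = {Z. \<exists>f. (\<forall>T. approximable {0..T} f) \<and> f 0 = mat 1 \<and>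
     (f has_vector_derivative Z) (at 0 within {0..})}"

lemma tangent_coneI:
  assumes "\<And>T. approximable {0..T} f" "f 0 = mat 1" "(f has_vector_derivative Z) (at 0 within {0..})"
  shows "Z \<in> tangent_cone"
  using assms unfolding tangent_cone_def by blast

lemma tangent_coneE:
  assumes "Z \<in> tangent_cone"
  obtains f where "\<And>T. approximable {0..T} f" "f 0 = mat 1" "(f has_vector_derivative Z) (at 0 within {0..})"
  using assms unfolding tangent_cone_def by blast

lemma tangent_cone_0: "0 \<in> tangent_cone"
  by (rule tangent_coneI[of "\<lambda>_. mat 1"])
     (auto intro: approximable_if_in_semigroup mat_1_mem)

lemma tangent_cone_add:
  assumes "Z \<in> tangent_cone" "W \<in> tangent_cone"
  shows "Z + W \<in> tangent_cone"
proof -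
  obtain f where f: "\<And>T. approximable {0..T} f" "f 0 = mat 1" "(f has_vector_derivative Z) (at 0 within {0..})"
    by (rule tangent_coneE[OF assms(1)], rule that)
  obtain h where h: "\<And>T. approximable {0..T} h" "h 0 = mat 1" "(h has_vector_derivative W) (at 0 within {0..})"
    by (rule tangent_coneE[OF assms(2)], rule that)
  show ?thesis
  proof (rule tangent_coneI)
    show "approximable {0..T} (\<lambda>t. f t ** h t)" for T
      by (rule approximable_mult[OF f(1) h(1)])
    show "((\<lambda>t. f t ** h t) has_vector_derivative Z + W) (at 0 within {0..})"
      using mm.has_vector_derivative[OF f(3) h(3)] by (simp add: f h add.commute)
  qed (simp add: f h)
qed

lemma tangent_cone_sum:
  assumes "\<And>x. x \<in> S \<Longrightarrow> Z x \<in> tangent_cone"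
  shows "sum Z S \<in> tangent_cone"
  using assms by (induction S rule: infinite_finite_induct) (auto intro: tangent_cone_0 tangent_cone_add)

lemma tangent_cone_scaleR:
  assumes "Z \<in> tangent_cone" "0 \<le> c"
  shows "c *\<^sub>R Z \<in> tangent_cone"
proof -
  obtain f where f: "\<And>T. approximable {0..T} f" "f 0 = mat 1" "(f has_vector_derivative Z) (at 0 within {0..})"
    by (rule tangent_coneE[OF assms(1)], rule that)
  show ?thesis
  proof (rule tangent_coneI)
    show "approximable {0..T} (\<lambda>t. f (c * t))" for T
      by (rule approximable_compose[OF f(1)[of "c * T"]])
         (use assms(2) in \<open>auto intro!: continuous_on_mult continuous_on_const continuous_on_id mult_left_mono\<close>)
    have "((*) c has_vector_derivative c) (at 0 within {0..})"
      by (auto intro!: derivative_eq_intros)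
    moreover have "(f has_vector_derivative Z) (at (c * 0) within (*) c ` {0..})"
      using f(3) assms(2) by (auto intro: has_vector_derivative_within_subset)
    ultimately show "((\<lambda>t. f (c * t)) has_vector_derivative c *\<^sub>R Z) (at 0 within {0..})"
      using vector_diff_chain_within[of "(*) c" c 0 "{0..}" f Z] by (simp add: o_def)
  qed (simp add: f)
qed

lemma tangent_cone_conj:
  assumes "Z \<in> tangent_cone" "Q \<in> closure R" "transpose Q \<in> closure R"
  shows "Q ** Z ** transpose Q \<in> tangent_cone"
proof -
  obtain f where f: "\<And>T. approximable {0..T} f" "f 0 = mat 1" "(f has_vector_derivative Z) (at 0 within {0..})"
    by (rule tangent_coneE[OF assms(1)], rule that)
  show ?thesis
  proof (rule tangent_coneI)
    show "approximable {0..T} (\<lambda>t. Q ** f t ** transpose Q)" for T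
      by (intro approximable_mult approximable_const assms f(1))
    show "Q ** f 0 ** transpose Q = mat 1"
      using assms(2) closure_subset_SO_group by (auto simp: f SO_group_def orthogonal_matrix_def)
    show "((\<lambda>t. Q ** f t ** transpose Q) has_vector_derivative Q ** Z ** transpose Q) (at 0 within {0..})"
      by (intro bounded_linear.has_vector_derivative[OF mm.bounded_linear_left]
          bounded_linear.has_vector_derivative[OF mm.bounded_linear_right] f(3))
  qed
qed

text \<open>A curve \<open>f\<close> with the same velocity as the rotation differs from it by \<open>o(h)\<close> at time \<open>h\<close>, so
  \<open>f (\<theta> / N)\<close> to the power \<open>N\<close> differs from the rotation by \<open>\<theta>\<close> only by \<open>N o(\<theta> / N)\<close>, which tends to zero.\<close>
lemma plane_rotation_in_closure:
  assumes pq: "p \<noteq> q" and B: "skew_mat p q \<in> tangent_cone" and \<theta>: "0 \<le> \<theta>"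
  shows "plane_rotation p q \<theta> \<in> closure R"
proof -
  obtain f where f: "\<And>T. approximable {0..T} f" "f 0 = mat 1"
      "(f has_vector_derivative skew_mat p q) (at 0 within {0..})"
    by (rule tangent_coneE[OF B], rule that)
  let ?r = "plane_rotation p q"
  have "((\<lambda>t. f t - ?r t) has_vector_derivative skew_mat p q - skew_mat p q ** ?r 0) (at 0 within {0..})"
    by (intro has_vector_derivative_diff f(3) plane_rotation_has_vector_derivative pq)
  then have D: "((\<lambda>t. f t - ?r t) has_derivative (\<lambda>_. 0)) (at 0 within {0..})"
    by (simp add: plane_rotation_0 has_vector_derivative_def)
  have powers: "\<exists>M\<in>closure R. norm (M - ?r (real n * h)) \<le> real n * norm (f h - ?r h)" if "0 \<le> h" for n h
  proof (induction n)
    case 0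
    then show ?case
      using mat_1_mem closure_subset by (intro bexI[of _ "mat 1"]) (auto simp: plane_rotation_0)
  next
    case (Suc n)
    then obtain M where M: "M \<in> closure R" "norm (M - ?r (real n * h)) \<le> real n * norm (f h - ?r h)" by blast
    have fh: "f h \<in> closure R"
      using approximable_in_closure[OF f(1)[of h], of h] that by simp
    have "?r (real (Suc n) * h) = ?r h ** ?r (real n * h)"
      by (simp add: plane_rotation_add[OF pq] algebra_simps)
    moreover have "norm (f h ** M - ?r h ** ?r (real n * h)) \<le> norm (f h - ?r h) + norm (M - ?r (real n * h))"
      using M(1) closure_subset_SO_group
      by (intro norm_diff_orthogonal_products orthogonal_plane_rotation pq) (auto simp: SO_group_def)
    ultimately have "norm (f h ** M - ?r (real (Suc n) * h)) \<le> real (Suc n) * norm (f h - ?r h)"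
      using M(2) by (simp add: algebra_simps)
    then show ?case
      using closure_mult[OF fh M(1)] by blast
  qed
  have "?r \<theta> \<in> closure (closure R)"
    unfolding closure_approachable[of _ "closure R"]
  proof (intro allI impI)
    fix e :: real assume e: "0 < e"
    \<comment> \<open>Adding \<open>1\<close> keeps the denominator positive when \<open>\<theta> = 0\<close>.\<close>
    define c where "c = e / (\<theta> + 1)"
    have c: "0 < c" "c * \<theta> < e"
      using e \<theta> by (auto simp: c_def field_simps)
    obtain d where d: "d > 0" "\<And>t. 0 \<le> t \<Longrightarrow> t < d \<Longrightarrow> norm (f t - ?r t) \<le> c * t"
      using D c(1) unfolding has_derivative_within_alt by (auto simp: f(2) plane_rotation_0)
    obtain N where N: "\<theta> / d < real N"
      using reals_Archimedean2 by blast
    have N0: "0 < real N"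
      using N \<theta> d(1) by (meson divide_nonneg_pos le_less_trans)
    define h where "h = \<theta> / real N"
    have h: "0 \<le> h" "h < d" "real N * h = \<theta>"
      using N N0 \<theta> d(1) by (auto simp: h_def field_simps)
    obtain M where M: "M \<in> closure R" "norm (M - ?r \<theta>) \<le> real N * norm (f h - ?r h)"
      using powers[OF h(1), of N] h(3) by auto
    have "real N * norm (f h - ?r h) \<le> real N * (c * h)"
      using d(2)[OF h(1,2)] N0 by (intro mult_left_mono) auto
    also have "\<dots> = c * \<theta>"
      using h(3) by (simp add: mult.left_commute)
    finally have "dist M (?r \<theta>) < e"
      using M(2) c(2) by (simp add: dist_norm)
    then show "\<exists>M\<in>closure R. dist M (?r \<theta>) < e"
      using M(1) by blast
  qed
  then show ?thesis by simp
qed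

definition rotatable :: "'n \<Rightarrow> 'n \<Rightarrow> bool" where
  "rotatable p q \<longleftrightarrow> skew_mat p q \<in> tangent_cone \<and> skew_mat q p \<in> tangent_cone"

lemma rotatable_refl: "rotatable p p"
  by (simp add: rotatable_def skew_mat_same tangent_cone_0)

lemma rotatable_sym: "rotatable p q \<longleftrightarrow> rotatable q p"
  by (auto simp: rotatable_def)

lemma rotatable_rotation:
  assumes "rotatable p q" "p \<noteq> q"
  shows "plane_rotation p q \<theta> \<in> closure R"
proof (cases "0 \<le> \<theta>")
  case False
  then show ?thesis
    using plane_rotation_in_closure[of q p "- \<theta>"] assms by (auto simp: rotatable_def plane_rotation_swap[of q p])
qed (use assms in \<open>auto simp: rotatable_def intro: plane_rotation_in_closure\<close>)

lemma rotatable_scaleR: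
  assumes "rotatable p q"
  shows "c *\<^sub>R skew_mat p q \<in> tangent_cone"
proof (cases "0 \<le> c")
  case False
  then have "(- c) *\<^sub>R skew_mat q p \<in> tangent_cone"
    using assms by (intro tangent_cone_scaleR) (auto simp: rotatable_def)
  then show ?thesis
    by (simp add: skew_mat_swap[of q p])
qed (use assms in \<open>auto simp: rotatable_def intro: tangent_cone_scaleR\<close>)

lemma rotatable_conj:
  assumes "rotatable p q" "p \<noteq> q" "Z \<in> tangent_cone"
  shows "plane_rotation p q \<theta> ** Z ** transpose (plane_rotation p q \<theta>) \<in> tangent_cone"
  using assms by (intro tangent_cone_conj) (auto simp: transpose_plane_rotation intro: rotatable_rotation)

text \<open>A quarter turn in the plane of \<open>q\<close> and \<open>r\<close> carries the axis of \<open>q\<close> to that of \<open>r\<close>, up to sign, and so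
  \<open>skew_mat p q\<close> to plus or minus \<open>skew_mat p r\<close>. Both signs are available.\<close>
lemma rotatable_trans:
  assumes "rotatable p q" "rotatable q r"
  shows "rotatable p r"
proof (cases "p = q \<or> q = r \<or> p = r")
  case False
  then have ne: "p \<noteq> q" "q \<noteq> r" "p \<noteq> r" by auto
  let ?g = "plane_rotation q r (pi / 2)"
  have "(?g ** skew_mat p q ** transpose ?g) $ x $ y = skew_mat r p $ x $ y"
     "(?g ** skew_mat q p ** transpose ?g) $ x $ y = skew_mat p r $ x $ y" for x y
    unfolding conj_skew_mat_nth plane_rotation_nth[OF ne(2)] skew_mat_nth using ne by auto
  then have "?g ** skew_mat p q ** transpose ?g = skew_mat r p" "?g ** skew_mat q p ** transpose ?g = skew_mat p r"
    by (simp_all add: vec_eq_iff)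
  then show ?thesis
    using rotatable_conj[OF assms(2) ne(2), of "skew_mat p q" "pi / 2"]
      rotatable_conj[OF assms(2) ne(2), of "skew_mat q p" "pi / 2"] assms(1)
    by (auto simp: rotatable_def)
qed (use assms rotatable_refl in auto)

end

section \<open>Isolating one entry of the drift\<close>

definition separates :: "('a \<times> 'a) set \<Rightarrow> 'a \<Rightarrow> 'a \<Rightarrow> bool" where
  "separates P x y \<longleftrightarrow> (\<exists>(a, b)\<in>P. (x \<in> {a, b}) \<noteq> (y \<in> {a, b}))"

lemma separates_empty: "\<not> separates {} x y"
  by (simp add: separates_def)

lemma separates_insert:
  "separates (insert (a, b) P) x y \<longleftrightarrow> (x \<in> {a, b}) \<noteq> (y \<in> {a, b}) \<or> separates P x y"
  by (simp add: separates_def)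

lemma separates_sym: "separates P y x \<longleftrightarrow> separates P x y"
  unfolding separates_def by (intro bex_cong refl) auto

context SO_semigroup begin

text \<open>Half the sum of \<open>Z\<close> and its conjugate by the half turn of \<open>a\<close>, \<open>b\<close> deletes the entries whose sign
  the half turn changes and keeps the others; the pairs of \<open>P\<close> are treated one after the other.\<close>
lemma tangent_cone_sign_average:
  assumes "finite P" "Z \<in> tangent_cone" "\<And>a b. (a, b) \<in> P \<Longrightarrow> a \<noteq> b \<and> rotatable a b"
  shows "(\<chi> x y. if separates P x y then 0 else Z $ x $ y) \<in> tangent_cone"
    (is "?avg P \<in> _")
  using assms(1,3)
proof (induction P rule: finite_induct)
  case empty
  have "?avg {} = Z" by (simp add: vec_eq_iff separates_empty)
  with assms(2) show ?case by simp
next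
  case (insert ab P)
  obtain a b where ab: "ab = (a, b)" by (cases ab)
  have r: "a \<noteq> b" "rotatable a b" using insert.prems[of a b] ab by auto
  have avg: "?avg P \<in> tangent_cone" using insert.prems insert.IH by blast
  let ?g = "plane_rotation a b pi"
  have "(1/2) *\<^sub>R (?avg P + ?g ** ?avg P ** transpose ?g) \<in> tangent_cone"
    by (intro tangent_cone_scaleR tangent_cone_add avg rotatable_conj r) simp
  moreover have "((1/2) *\<^sub>R (?avg P + ?g ** ?avg P ** transpose ?g)) $ x $ y = ?avg (insert ab P) $ x $ y" for x y
    unfolding vector_scaleR_component vector_add_component conj_half_turn_nth[OF r(1)] ab
      vec_lambda_beta separates_insert
    by (cases "separates P x y"; cases "x \<in> {a, b}"; cases "y \<in> {a, b}") simp_all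
  then have "(1/2) *\<^sub>R (?avg P + ?g ** ?avg P ** transpose ?g) = ?avg (insert ab P)"
    unfolding vec_eq_iff by blast
  ultimately show ?case by (simp only:)
qed

text \<open>The half turn of \<open>p\<close> and \<open>b\<close> flips the axis of \<open>p\<close> but not that of \<open>q\<close>, so it reverses \<open>skew_mat p q\<close>.\<close>
lemma rotatable_if_flippable:
  assumes "skew_mat p q \<in> tangent_cone" "rotatable p b" "b \<noteq> p" "b \<noteq> q" "p \<noteq> q"
  shows "rotatable p q"
proof -
  let ?g = "plane_rotation p b pi"
  have "(?g ** skew_mat p q ** transpose ?g) $ x $ y = skew_mat q p $ x $ y" for x y
    unfolding conj_half_turn_nth[OF not_sym[OF assms(3)]] skew_mat_nth using assms by auto
  then have "?g ** skew_mat p q ** transpose ?g = skew_mat q p"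
    by (simp add: vec_eq_iff)
  then show ?thesis
    using rotatable_conj[OF assms(2) not_sym[OF assms(3)] assms(1), of pi] assms(1)
    by (simp add: rotatable_def)
qed

lemma rotatable_third_node:
  assumes "card {y. rotatable x y} \<ge> 3"
  obtains b where "rotatable x b" "b \<noteq> u" "b \<noteq> v"
proof -
  have "\<not> {y. rotatable x y} \<subseteq> {u, v}"
  proof
    assume "{y. rotatable x y} \<subseteq> {u, v}"
    then have "card {y. rotatable x y} \<le> card {u, v}"
      by (intro card_mono) auto
    also have "\<dots> \<le> 2"
      by (simp add: card_insert_if)
    finally show False using assms by simp
  qed
  then show ?thesis using that by auto
qed

text \<open>In the average \<open>Y\<close> over the half turns of all rotatable pairs that avoid \<open>p\<close> and \<open>q\<close>, the only entries
  between different classes that survive are those at \<open>(p, q)\<close> and \<open>(q, p)\<close>. The entries within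
  classes are removed by adding multiples of \<open>skew_mat a b\<close> for rotatable \<open>a\<close>, \<open>b\<close>. Since the cone
  admits only nonnegative factors, this yields \<open>skew_mat p q\<close> with one sign, and a flip gives the
  other.\<close>
lemma drift_edge_rotatable:
  assumes Z: "Z \<in> tangent_cone" "Z \<in> so_algebra" "Z $ p $ q \<noteq> 0"
    and card: "\<And>x. card {y. rotatable x y} \<ge> 3"
  shows "rotatable p q"
proof (rule ccontr)
  assume nr: "\<not> rotatable p q"
  then have pq: "p \<noteq> q" using rotatable_refl by auto
  have skew: "Z $ y $ x = - (Z $ x $ y)" for x y
    using Z(2) unfolding so_algebra_iff by blast
  define P where "P = {(a, b). a \<noteq> b \<and> rotatable a b \<and> p \<notin> {a, b} \<and> q \<notin> {a, b}}"
  define Y where "Y = (\<chi> x y. if separates P x y then 0 else Z $ x $ y)"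
  have Y: "Y \<in> tangent_cone"
    unfolding Y_def by (rule tangent_cone_sign_average[OF finite Z(1)]) (auto simp: P_def)
  have Y0: "Y $ x $ y = 0" if "\<not> rotatable x y" "x \<notin> {p, q}" for x y
  proof -
    \<comment> \<open>The class of \<open>x\<close> meets \<open>{p, q}\<close> in at most one node \<open>c\<close>, as \<open>p\<close> and \<open>q\<close> lie in different classes.\<close>
    obtain c where c: "c = p \<or> c = q" "\<And>b. rotatable x b \<Longrightarrow> b \<noteq> c \<Longrightarrow> b \<noteq> p \<and> b \<noteq> q"
      using nr rotatable_trans rotatable_sym by metis
    obtain b where b: "rotatable x b" "b \<noteq> x" "b \<noteq> c"
      by (rule rotatable_third_node[OF card])
    have "(x, b) \<in> P"
      using that(2) b c(2)[OF b(1,3)] by (auto simp: P_def)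
    moreover have "y \<notin> {x, b}"
      using that(1) b(1) rotatable_refl by auto
    ultimately have "separates P x y"
      unfolding separates_def by (intro bexI[of _ "(x, b)"]) auto
    then show ?thesis by (simp add: Y_def)
  qed
  have Yskew: "Y $ y $ x = - (Y $ x $ y)" for x y
    using skew[of y x] by (simp add: Y_def separates_sym[of P y x])
  have Ypq: "Y $ p $ q = Z $ p $ q"
    by (auto simp: Y_def P_def separates_def)
  \<comment> \<open>Halving compensates for the fact that the sum over ordered pairs counts every entry twice.\<close>
  define W where "W = (\<chi> x y. if rotatable x y then Y $ x $ y / 2 else 0)"
  define V where "V = W - transpose W"
  have V: "V $ x $ y = (if rotatable x y then Y $ x $ y else 0)" for x y
    using Yskew[of x y] rotatable_sym[of x y] by (auto simp: V_def W_def transpose_def)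
  have "(\<Sum>a\<in>UNIV. \<Sum>b\<in>UNIV. (- W)$a$b *\<^sub>R skew_mat a b) \<in> tangent_cone"
  proof (intro tangent_cone_sum)
    fix a b
    show "(- W)$a$b *\<^sub>R skew_mat a b \<in> tangent_cone"
      using rotatable_scaleR[of a b "(- W)$a$b"] tangent_cone_0
      by (cases "rotatable a b") (simp_all add: W_def)
  qed
  then have "Y + (- W - transpose (- W)) \<in> tangent_cone"
    unfolding skew_mat_sum by (rule tangent_cone_add[OF Y])
  moreover have "Y + (- W - transpose (- W)) = (Z $ p $ q) *\<^sub>R skew_mat p q"
  proof -
    have "(Y - V) $ x $ y = ((Z $ p $ q) *\<^sub>R skew_mat p q) $ x $ y" for x y
    proof (cases "x \<in> {p, q} \<and> y \<in> {p, q}")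
      case True
      then show ?thesis
        unfolding vector_minus_component V vector_scaleR_component skew_mat_nth
        using pq nr rotatable_sym[of p q] rotatable_refl Ypq Yskew[of p q] Yskew[of p p] Yskew[of q q]
        by auto
    next
      case False
      have "Y $ x $ y = 0" if nr: "\<not> rotatable x y"
      proof (cases "x \<in> {p, q}")
        case True
        with False have "y \<notin> {p, q}" by blast
        with nr have "Y $ y $ x = 0"
          by (intro Y0) (simp_all add: rotatable_sym[of y x])
        then show ?thesis
          using Yskew[of y x] by simp
      qed (rule Y0[OF nr])
      then have "Y $ x $ y - (if rotatable x y then Y $ x $ y else 0) = 0"
        by simp
      moreover have "(x = p \<and> y = q) = False" "(x = q \<and> y = p) = False"
        using False by blast+
      ultimately show ?thesis
        by (simp only: vector_minus_component V vector_scaleR_component skew_mat_nth if_False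
            diff_zero scaleR_zero_right)
    qed
    then have "Y - V = (Z $ p $ q) *\<^sub>R skew_mat p q"
      unfolding vec_eq_iff by blast
    then show ?thesis
      by (simp add: V_def transpose_minus algebra_simps)
  qed
  ultimately have "(Z $ p $ q) *\<^sub>R skew_mat p q \<in> tangent_cone"
    by (simp only:)
  then have "(1 / \<bar>Z $ p $ q\<bar>) *\<^sub>R ((Z $ p $ q) *\<^sub>R skew_mat p q) \<in> tangent_cone"
    by (rule tangent_cone_scaleR) simp
  moreover have "(1 / \<bar>Z $ p $ q\<bar>) *\<^sub>R ((Z $ p $ q) *\<^sub>R skew_mat p q)
      = (if Z $ p $ q > 0 then skew_mat p q else skew_mat q p)"
    using Z(3) by (auto simp: skew_mat_swap[of q p])
  ultimately consider "skew_mat p q \<in> tangent_cone" | "skew_mat q p \<in> tangent_cone"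
    by (metis (full_types))
  then show False
  proof cases
    case 1
    obtain b where "rotatable p b" "b \<noteq> p" "b \<noteq> q"
      by (rule rotatable_third_node[OF card])
    with 1 pq nr show False using rotatable_if_flippable by blast
  next
    case 2
    obtain b where "rotatable q b" "b \<noteq> q" "b \<noteq> p"
      by (rule rotatable_third_node[OF card])
    with 2 pq nr show False using rotatable_if_flippable rotatable_sym by metis
  qed
qed

end

section \<open>The reachable set as a semigroup\<close>

lemma SO_semigroup_reachable:
  assumes "A \<in> so_algebra"
  shows "SO_semigroup (reachable A m i j)"
  by unfold_locales (use mat_1_reachable reachable_mult reachable_subset_SO[OF assms] in auto)

lemma drift_in_tangent_cone:
  assumes "A \<in> so_algebra"
  shows "A \<in> SO_semigroup.tangent_cone (reachable A m i j)"
proof -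
  interpret SO_semigroup "reachable A m i j"
    by (rule SO_semigroup_reachable[OF assms])
  show ?thesis
  proof (rule tangent_coneI)
    show "approximable {0..T} (\<lambda>t. matrix_exp t A)" for T
      using matrix_exp_control_field_reachable[where A = A and c = "\<lambda>_. 0" and m = m and i = i and j = j]
      by (intro approximable_if_in_semigroup continuous_on_vector_derivative[OF matrix_exp_has_vector_derivative]) auto
    show "((\<lambda>t. matrix_exp t A) has_vector_derivative A) (at 0 within {0..})"
      using matrix_exp_has_vector_derivative[of A 0 "{0..}"] by (simp add: matrix_exp_0)
  qed (rule matrix_exp_0)
qed

text \<open>Under the constant control of size \<open>N s\<close>, run for the short time \<open>t / N\<close>, the effective generator
  is \<open>A / N + s B\<close>. Uniformly in \<open>t\<close>, its flow converges to the rotation generated by \<open>s B\<close> as \<open>N\<close> grows.\<close>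
lemma controlled_direction_in_tangent_cone:
  fixes A :: "real^'n^'n"
  assumes A: "A \<in> so_algebra" and k: "k \<in> {1..m}" and ij: "i k \<noteq> j k"
  shows "s *\<^sub>R skew_mat (i k) (j k) \<in> SO_semigroup.tangent_cone (reachable A m i j)"
proof -
  interpret SO_semigroup "reachable A m i j"
    by (rule SO_semigroup_reachable[OF A])
  let ?B = "skew_mat (i k) (j k)" and ?Y = "\<lambda>t. plane_rotation (i k) (j k) (s * t)"
  have dY: "(?Y has_vector_derivative (s *\<^sub>R ?B) ** ?Y t) (at t within S)" for t S
  proof -
    have "((*) s has_vector_derivative s) (at t within S)"
      by (auto intro!: derivative_eq_intros)
    from vector_diff_chain_within[OF this plane_rotation_has_vector_derivative[OF ij]]
    show ?thesis by (simp add: o_def mm.scaleR_left)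
  qed
  show ?thesis
  proof (rule tangent_coneI)
    show "(?Y has_vector_derivative s *\<^sub>R ?B) (at 0 within {0..})"
      using dY[of 0 "{0..}"] by (simp add: plane_rotation_0)
    fix T :: real
    show "approximable {0..T} ?Y"
      unfolding approximable_def
    proof (intro allI impI)
      fix e :: real assume e: "0 < e"
      obtain N where N: "norm A * \<bar>T\<bar> / e < real N"
        using reals_Archimedean2 by blast
      then have N0: "0 < real N"
        using e by (meson divide_nonneg_pos le_less_trans mult_nonneg_nonneg norm_ge_zero abs_ge_zero)
      let ?C = "control_field A m i j (\<lambda>l. if l = k then real N * s else 0)"
      have C: "?C = A + (real N * s) *\<^sub>R ?B"
        using k by (simp add: if_distrib[of "\<lambda>c. c *\<^sub>R _"] if_distribR sum.delta cong: if_cong)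
      let ?X = "\<lambda>t. matrix_exp (inverse (real N) * t) ?C"
      let ?W = "inverse (real N) *\<^sub>R A + s *\<^sub>R ?B"
      have dX: "(?X has_vector_derivative ?W ** ?X t) (at t within S)" for t S
      proof -
        have "((*) (inverse (real N)) has_vector_derivative inverse (real N)) (at t within S)"
          by (auto intro!: derivative_eq_intros)
        from vector_diff_chain_within[OF this matrix_exp_has_vector_derivative]
        have "(?X has_vector_derivative (inverse (real N) *\<^sub>R ?C) ** ?X t) (at t within S)"
          by (simp add: o_def mm.scaleR_left)
        moreover have "inverse (real N) *\<^sub>R ?C = ?W"
          unfolding C using N0 by (simp add: scaleR_add_right)
        ultimately show ?thesis by simp
      qed
      have so: "?W \<in> so_algebra" "s *\<^sub>R ?B \<in> so_algebra"
        using A by (simp_all add: so_algebra_def transpose_add transpose_scalar transpose_skew_mat)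
      have "norm (?X t - ?Y t) < e" if "t \<in> {0..T}" for t
      proof -
        have "norm (?X t - ?Y t) \<le> norm (?W - s *\<^sub>R ?B) * t"
          using that dX dY so
          by (intro skew_flow_diff_le) (auto simp: matrix_exp_0 plane_rotation_0)
        also have "\<dots> \<le> norm A / real N * \<bar>T\<bar>"
          using that by (intro mult_mono) (auto simp: divide_inverse mult.commute)
        also have "\<dots> < e"
          using N N0 e by (simp add: field_simps)
        finally show ?thesis .
      qed
      moreover have "?X t \<in> reachable A m i j" if "t \<in> {0..T}" for t
        using that N0 by (intro matrix_exp_control_field_reachable) auto
      moreover have "continuous_on {0..T} ?X"
        by (rule continuous_on_vector_derivative[OF dX])
      ultimately show "\<exists>g. continuous_on {0..T} g \<and>
          (\<forall>t\<in>{0..T}. g t \<in> reachable A m i j \<and> norm (g t - ?Y t) < e)"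
        by (intro exI[of _ ?X]) auto
    qed
  qed (simp add: plane_rotation_0)
qed

lemma controlled_pair_rotatable:
  fixes A :: "real^'n^'n"
  assumes "A \<in> so_algebra" "k \<in> {1..m}" "i k \<noteq> j k"
  shows "SO_semigroup.rotatable (reachable A m i j) (i k) (j k)"
proof -
  interpret SO_semigroup "reachable A m i j"
    by (rule SO_semigroup_reachable[OF assms(1)])
  show ?thesis
    unfolding rotatable_def
    using controlled_direction_in_tangent_cone[where A = A and m = m and i = i and j = j and k = k and s = 1, OF assms] controlled_direction_in_tangent_cone[where A = A and m = m and i = i and j = j and k = k and s = "-1", OF assms]
    by (simp add: skew_mat_swap[of "j k"])
qed

section \<open>Density\<close>

text \<open>At the maximum, the derivative in the direction of each plane rotation vanishes, which says that
  \<open>N = W M\<close> is symmetric, where \<open>W\<close> is the diagonal matrix of the weights. As \<open>M\<close> is orthogonal,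
  \<open>N\<^sup>2 = N N\<^sup>T = W\<^sup>2\<close>, so \<open>N\<close> commutes with \<open>W\<^sup>2\<close>; the weights are distinct and positive, so \<open>N\<close> and
  \<open>M\<close> are diagonal. Two diagonal entries \<open>-1\<close> could be improved by a half turn, and a single one is
  excluded by the determinant.\<close>
lemma trace_maximal_imp_identity:
  fixes M :: "real^'n^'n" and w :: "'n \<Rightarrow> real"
  assumes M: "M \<in> SO_group" and w: "inj w" "\<And>a. 0 < w a"
    and max: "\<And>p q \<theta>. p \<noteq> q \<Longrightarrow>
      (\<Sum>a\<in>UNIV. w a * (M ** plane_rotation p q \<theta>) $ a $ a) \<le> (\<Sum>a\<in>UNIV. w a * M $ a $ a)"
  shows "M = mat 1"
proof -
  define \<phi> where "\<phi> = (\<lambda>N :: real^'n^'n. \<Sum>a\<in>UNIV. w a * N $ a $ a)"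
  have lin: "\<phi> (N + N') = \<phi> N + \<phi> N'" "\<phi> (N - N') = \<phi> N - \<phi> N'" "\<phi> (c *\<^sub>R N) = c * \<phi> N" for N N' c
    by (simp_all add: \<phi>_def algebra_simps sum.distrib sum_subtractf sum_distrib_left)
  have unit: "\<phi> (M ** unit_mat p q) = w q * M $ q $ p" for p q
  proof -
    have "\<phi> (M ** unit_mat p q) = (\<Sum>a\<in>UNIV. if a = q then w q * M $ q $ p else 0)"
      unfolding \<phi>_def
      by (intro sum.cong refl) (simp add: mult_unit_mat_nth)
    then show ?thesis by simp
  qed
  have le: "sin \<theta> * (w q * M $ q $ p - w p * M $ p $ q) + (cos \<theta> - 1) * (w p * M $ p $ p + w q * M $ q $ q) \<le> 0"
    if "p \<noteq> q" for p q \<theta>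
  proof -
    have "\<phi> (M ** plane_rotation p q \<theta>) \<le> \<phi> M"
      unfolding \<phi>_def by (rule max[OF that])
    then show ?thesis
      by (simp add: plane_rotation_def mm.add_right mm.scaleR_right mm.diff_right skew_mat_def lin unit)
  qed
  have sym: "w p * M $ p $ q = w q * M $ q $ p" for p q
  proof (cases "p = q")
    case False
    let ?g = "\<lambda>\<theta>. sin \<theta> * (w q * M $ q $ p - w p * M $ p $ q) + (cos \<theta> - 1) * (w p * M $ p $ p + w q * M $ q $ q)"
    have d: "(?g has_real_derivative (w q * M $ q $ p - w p * M $ p $ q)) (at 0)"
      by (auto intro!: derivative_eq_intros)
    have "\<forall>\<theta>. \<bar>0 - \<theta>\<bar> < 1 \<longrightarrow> ?g \<theta> \<le> ?g 0"
      using le[OF False] by simp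
    from DERIV_local_max[OF d zero_less_one this]
    have "w q * M $ q $ p - w p * M $ p $ q = 0" .
    then show ?thesis by simp
  qed simp
  have orth: "M ** transpose M = mat 1"
    using M by (simp add: SO_group_def orthogonal_matrix_def)
  have diag: "M $ p $ q = 0" if "p \<noteq> q" for p q
  proof -
    define W N where "W = (\<chi> a b. if a = b then w a else (0::real))" and "N = W ** M"
    have WM: "(W ** X) $ a $ b = w a * X $ a $ b" for X :: "real^'n^'n" and a b
    proof -
      have "(W ** X) $ a $ b = (\<Sum>k\<in>UNIV. if k = a then w a * X $ a $ b else 0)"
        unfolding matrix_matrix_mult_def W_def vec_lambda_beta by (intro sum.cong refl) auto
      then show ?thesis by simp
    qed
    have MW: "(X ** W) $ a $ b = X $ a $ b * w b" for X :: "real^'n^'n" and a b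
    proof -
      have "(X ** W) $ a $ b = (\<Sum>k\<in>UNIV. if k = b then X $ a $ b * w b else 0)"
        unfolding matrix_matrix_mult_def W_def vec_lambda_beta by (intro sum.cong refl) auto
      then show ?thesis by simp
    qed
    have tW: "transpose W = W"
      by (auto simp: W_def transpose_def vec_eq_iff)
    have tN: "transpose N = N"
    proof -
      have "transpose N $ a $ b = N $ a $ b" for a b
        using sym[of a b] by (simp add: transpose_def N_def WM)
      then show ?thesis unfolding vec_eq_iff by blast
    qed
    have "N ** N = N ** transpose N"
      by (simp add: tN)
    also have "\<dots> = W ** (M ** transpose M) ** W"
      by (simp add: N_def matrix_transpose_mul tW matrix_mul_assoc)
    finally have NN: "N ** N = W ** W"
      by (simp add: orth)
    have "N ** (W ** W) = (W ** W) ** N"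
      by (simp add: matrix_mul_assoc flip: NN)
    then have "(N ** W ** W) $ p $ q = (W ** (W ** N)) $ p $ q"
      by (simp add: matrix_mul_assoc)
    then have "N $ p $ q * (w q * w q - w p * w p) = 0"
      by (simp add: WM MW algebra_simps)
    moreover have "w q * w q \<noteq> w p * w p"
      using that injD[OF w(1), of p q] w(2)[of p] w(2)[of q] by (auto simp: square_eq_iff)
    ultimately show ?thesis
      using w(2)[of p] by (simp add: N_def WM)
  qed
  have sq: "M $ p $ p = 1 \<or> M $ p $ p = -1" for p
  proof -
    have "(M ** transpose M) $ p $ p = (\<Sum>k\<in>UNIV. if k = p then M $ p $ p * M $ p $ p else 0)"
      unfolding matrix_matrix_mult_def transpose_def vec_lambda_beta
      by (intro sum.cong refl) (use diag in auto)
    then have "M $ p $ p * M $ p $ p = 1"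
      by (simp add: orth mat_def)
    then show ?thesis
      by (simp add: square_eq_1_iff)
  qed
  have unique_neg: "M $ q $ q = 1" if "M $ p $ p = -1" "q \<noteq> p" for p q
    using le[of p q pi] sq[of q] that w(2)[of p] w(2)[of q] by auto
  have "M $ p $ p = 1" for p
  proof (rule ccontr)
    assume "M $ p $ p \<noteq> 1"
    with sq have p: "M $ p $ p = -1" by blast
    have "det M = (\<Prod>q\<in>UNIV. M $ q $ q)"
      by (rule det_diagonal) (use diag in auto)
    also have "\<dots> = M $ p $ p * (\<Prod>q\<in>UNIV - {p}. M $ q $ q)"
      by (rule prod.remove) auto
    also have "(\<Prod>q\<in>UNIV - {p}. M $ q $ q) = 1"
      by (rule prod.neutral) (use unique_neg[OF p] in auto)
    finally show False
      using M p by (simp add: SO_group_def)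
  qed
  then have "M $ p $ q = (mat 1 :: real^'n^'n) $ p $ q" for p q
    using diag by (simp add: mat_def)
  then show ?thesis
    unfolding vec_eq_iff by blast
qed

context SO_semigroup begin

text \<open>A maximiser \<open>P\<close> of the weighted trace of \<open>Q P\<close> on the closure satisfies \<open>Q P = 1\<close>, so the closure
  contains the inverse of every rotation \<open>Q\<close>, and hence every rotation.\<close>
lemma dense_if_all_rotatable:
  assumes rot: "\<And>p q. rotatable p q"
  shows "closure R = SO_group"
proof (rule equalityI[OF closure_subset_SO_group])
  obtain f :: "'n \<Rightarrow> nat" and n where f: "inj f"
    using finite_imp_inj_to_nat_seg[of "UNIV :: 'n set"] by auto
  define w where "w a = real (f a) + 1" for a
  have w: "inj w" "\<And>a. 0 < w a"
    using f by (auto simp: w_def inj_def)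
  have inv: "transpose Q \<in> closure R" if Q: "Q \<in> SO_group" for Q
  proof -
    have "compact (closure R)"
      unfolding compact_closure
      by (rule bounded_subset[OF compact_imp_bounded[OF orthogonal_matrix_compact]])
         (use subset_SO_group in \<open>auto simp: SO_group_def\<close>)
    moreover have "closure R \<noteq> {}"
      using mat_1_mem closure_subset by blast
    moreover have "continuous_on (closure R) (\<lambda>P. \<Sum>a\<in>UNIV. w a * (Q ** P) $ a $ a)"
      by (intro continuous_on_sum continuous_on_mult continuous_on_const continuous_on_component
          mm.continuous_on continuous_on_id)
    ultimately have "\<exists>P\<in>closure R. \<forall>P'\<in>closure R.
        (\<Sum>a\<in>UNIV. w a * (Q ** P') $ a $ a) \<le> (\<Sum>a\<in>UNIV. w a * (Q ** P) $ a $ a)"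
      by (rule continuous_attains_sup)
    then obtain P where P: "P \<in> closure R" "\<And>P'. P' \<in> closure R \<Longrightarrow>
        (\<Sum>a\<in>UNIV. w a * (Q ** P') $ a $ a) \<le> (\<Sum>a\<in>UNIV. w a * (Q ** P) $ a $ a)"
      by (elim bexE) (rule that, assumption, erule bspec)
    have "Q ** P = mat 1"
    proof (rule trace_maximal_imp_identity[OF _ w])
      show "Q ** P \<in> SO_group"
        using P(1) closure_subset_SO_group by (intro SO_group_mult Q) auto
      show "(\<Sum>a\<in>UNIV. w a * (Q ** P ** plane_rotation p q \<theta>) $ a $ a) \<le> (\<Sum>a\<in>UNIV. w a * (Q ** P) $ a $ a)"
        if "p \<noteq> q" for p q \<theta>
        using P(2)[OF closure_mult[OF P(1) rotatable_rotation[OF rot that]]]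
        by (simp add: matrix_mul_assoc)
    qed
    then have "transpose Q ** (Q ** P) = transpose Q"
      by simp
    then show ?thesis
      using Q P(1) by (simp add: matrix_mul_assoc SO_group_def orthogonal_matrix_def)
  qed
  show "SO_group \<subseteq> closure R"
    using inv SO_group_transpose by (metis subsetI transpose_transpose)
qed

end

section \<open>A neighbourhood of the identity\<close>

text \<open>The skew part serves as a chart of the rotation group near the identity. It is linear and takes its
  values in a vector space, where balls are convex, as Brouwer's theorem requires.\<close>
definition skew_part :: "real^'n^'n \<Rightarrow> real^'n^'n" where
  "skew_part M = (1/2) *\<^sub>R (M - transpose M)"

lemma bounded_linear_skew_part: "bounded_linear (skew_part :: real^'n^'n \<Rightarrow> real^'n^'n)"
  unfolding skew_part_def[abs_def]
  by (intro bounded_linear_intros bounded_linear_sub bounded_linear_ident bounded_linear_transpose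
      bounded_linear_compose[OF bounded_linear_scaleR_right])

lemma norm_skew_part_le: "norm (skew_part M) \<le> norm (M :: real^'n^'n)"
  using norm_triangle_ineq4[of M "transpose M"] by (simp add: skew_part_def norm_transpose)

lemma skew_part_in_so_algebra: "skew_part M \<in> so_algebra"
  by (simp add: so_algebra_def skew_part_def transpose_scalar transpose_diff algebra_simps)

lemma skew_part_eq: "S \<in> so_algebra \<Longrightarrow> skew_part S = S"
  by (simp add: so_algebra_def skew_part_def flip: scaleR_2)

lemma skew_part_mat_1: "skew_part (mat 1) = 0"
  by (simp add: skew_part_def)

lemma subspace_so_algebra: "subspace (so_algebra :: (real^'n^'n) set)"
  by (rule subspaceI) (simp_all add: so_algebra_def transpose_add transpose_scalar
      linear_0[OF bounded_linear.linear[OF bounded_linear_transpose]])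

text \<open>For orthogonal \<open>P\<close> one has \<open>(P + P\<^sup>T)\<^sup>2 = (P - P\<^sup>T)\<^sup>2 + 4\<close>, so the skew part determines the square of
  \<open>S P = P + P\<^sup>T\<close>. Near the identity it determines \<open>S P\<close> itself: the difference \<open>D\<close> of two such square
  roots satisfies \<open>D (S P + S Q) + (S P + S Q) D = 0\<close>, where \<open>S P + S Q = 4 + E\<close> with \<open>norm E < 4\<close>, and
  thus \<open>8 norm D \<le> 2 norm E norm D\<close> forces \<open>D = 0\<close>.\<close>
lemma skew_part_inj_near_mat_1:
  fixes P Q :: "real^'n^'n"
  assumes P: "orthogonal_matrix P" "norm (P - mat 1) < 1"
    and Q: "orthogonal_matrix Q" "norm (Q - mat 1) < 1"
    and eq: "skew_part P = skew_part Q"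
  shows "P = Q"
proof -
  define S where "S = (\<lambda>M :: real^'n^'n. M + transpose M)"
  have eq': "P - transpose P = Q - transpose Q"
    using eq by (simp add: skew_part_def)
  have square: "S M ** S M = (M - transpose M) ** (M - transpose M) + (mat 1 + mat 1 + (mat 1 + mat 1))"
    if "orthogonal_matrix M" for M
  proof -
    have "M ** transpose M = mat 1" "transpose M ** M = mat 1"
      using that by (simp_all add: orthogonal_matrix_def)
    then show ?thesis
      by (simp add: S_def mm.add_left mm.add_right mm.diff_left mm.diff_right algebra_simps)
  qed
  define D E where "D = S P - S Q" and "E = (S P - 2 *\<^sub>R mat 1) + (S Q - 2 *\<^sub>R mat 1)"
  have S1: "norm (S M - 2 *\<^sub>R mat 1) < 2" if "norm (M - mat 1) < 1" for M
  proof -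
    have "S M - 2 *\<^sub>R mat 1 = (M - mat 1) + transpose (M - mat 1)"
      by (simp add: S_def transpose_diff scaleR_2)
    then have "norm (S M - 2 *\<^sub>R mat 1) \<le> norm (M - mat 1) + norm (transpose (M - mat 1))"
      by (metis norm_triangle_ineq)
    then show ?thesis
      using that by (simp add: norm_transpose)
  qed
  have E: "norm E < 4"
    unfolding E_def using norm_triangle_lt[of "S P - 2 *\<^sub>R mat 1" "S Q - 2 *\<^sub>R mat 1" 4]
      S1[OF P(2)] S1[OF Q(2)] by linarith
  have "D ** (S P + S Q) + (S P + S Q) ** D = 2 *\<^sub>R (S P ** S P - S Q ** S Q)"
    by (simp add: D_def mm.add_left mm.add_right mm.diff_left mm.diff_right scaleR_2 algebra_simps)
  also have "\<dots> = 0"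
    by (simp add: square[OF P(1)] square[OF Q(1)] eq')
  also have "S P + S Q = 4 *\<^sub>R mat 1 + E"
  proof -
    have "(4 :: real) *\<^sub>R mat 1 = 2 *\<^sub>R mat 1 + (2 *\<^sub>R mat 1 :: real^'n^'n)"
      unfolding scaleR_add_left[symmetric] by simp
    then show ?thesis
      unfolding E_def by (simp only: add_diff_eq diff_add_eq add.assoc add.commute add.left_commute) simp
  qed
  finally have "4 *\<^sub>R D + 4 *\<^sub>R D + (D ** E + E ** D) = 0"
    by (simp add: mm.add_left mm.add_right mm.scaleR_left mm.scaleR_right add.assoc add.left_commute)
  moreover have "4 *\<^sub>R D + 4 *\<^sub>R D = 8 *\<^sub>R D"
    unfolding scaleR_add_left[symmetric] by simp
  ultimately have "8 *\<^sub>R D = - (D ** E + E ** D)"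
    by (simp only: eq_neg_iff_add_eq_0)
  then have "8 * norm D = norm (D ** E + E ** D)"
    by (metis norm_minus_cancel norm_scaleR abs_numeral)
  also have "\<dots> \<le> norm D * norm E + norm E * norm D"
    by (intro norm_triangle_mono norm_matrix_mult_le)
  finally have "(4 - norm E) * norm D \<le> 0"
    by (simp add: algebra_simps)
  then have "D = 0"
    using E by (simp add: mult_le_0_iff)
  then have "P + transpose P = Q + transpose Q"
    by (simp add: D_def S_def)
  then have "(P + transpose P) + (P - transpose P) = (Q + transpose Q) + (Q - transpose Q)"
    unfolding eq' by (rule arg_cong)
  moreover have "2 *\<^sub>R M = (M + transpose M) + (M - transpose M)" for M :: "real^'n^'n"
    by (simp add: scaleR_2)
  ultimately have "2 *\<^sub>R P = 2 *\<^sub>R Q"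
    by (simp only:)
  then show ?thesis by simp
qed

context SO_semigroup begin

text \<open>The curves for the two signs are glued at time zero by multiplying them, each one being stopped at
  the identity while the other one runs.\<close>
lemma two_sided_curve:
  assumes "rotatable p q"
  obtains f where "\<And>T. approximable {-T..T} f" "f 0 = mat 1" "(f has_vector_derivative skew_mat p q) (at 0)"
proof -
  obtain f where f: "\<And>T. approximable {0..T} f" "f 0 = mat 1" "(f has_vector_derivative skew_mat p q) (at 0 within {0..})"
    by (rule tangent_coneE[of "skew_mat p q"]) (use assms in \<open>simp add: rotatable_def\<close>, rule that)
  obtain h where h: "\<And>T. approximable {0..T} h" "h 0 = mat 1" "(h has_vector_derivative skew_mat q p) (at 0 within {0..})"
    by (rule tangent_coneE[of "skew_mat q p"]) (use assms in \<open>simp add: rotatable_def\<close>, rule that)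
  let ?f = "\<lambda>t. f (max t 0) ** h (max (- t) 0)"
  show thesis
  proof (rule that)
    show "approximable {-T..T} ?f" for T
    proof (cases "T \<ge> 0")
      case True
      then show ?thesis
        by (intro approximable_mult approximable_compose[OF f(1)[of T]] approximable_compose[OF h(1)[of T]]
            continuous_on_max continuous_on_minus continuous_on_id continuous_on_const) auto
    next
      case False
      then have "{-T..T} = {}" by auto
      then show ?thesis by (simp add: approximable_def)
    qed
    show "?f 0 = mat 1" by (simp add: f(2) h(2))
    show "(?f has_vector_derivative skew_mat p q) (at 0)"
      unfolding has_vector_derivative_def has_derivative_at_alt
    proof (intro conjI allI impI)
      show "bounded_linear (\<lambda>t. t *\<^sub>R skew_mat p q)"
        by (rule bounded_linear_scaleR_left)
      fix e :: real assume e: "0 < e"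
      obtain d where d: "d > 0" "\<And>t. 0 \<le> t \<Longrightarrow> t < d \<Longrightarrow> norm (f t - mat 1 - t *\<^sub>R skew_mat p q) \<le> e * t"
        using f(3) e unfolding has_vector_derivative_def has_derivative_within_alt by (auto simp: f(2))
      obtain d' where d': "d' > 0" "\<And>t. 0 \<le> t \<Longrightarrow> t < d' \<Longrightarrow> norm (h t - mat 1 - t *\<^sub>R skew_mat q p) \<le> e * t"
        using h(3) e unfolding has_vector_derivative_def has_derivative_within_alt by (auto simp: h(2))
      have "norm (?f t - ?f 0 - (t - 0) *\<^sub>R skew_mat p q) \<le> e * norm (t - 0)" if t: "norm (t - 0) < min d d'" for t
      proof (cases "0 \<le> t")
        case True
        then show ?thesis using d(2)[of t] t by (simp add: f(2) h(2))
      next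
        case False
        then show ?thesis using d'(2)[of "- t"] t by (simp add: f(2) h(2) skew_mat_swap[of q p])
      qed
      then show "\<exists>d>0. \<forall>t. norm (t - 0) < d \<longrightarrow>
          norm (?f t - ?f 0 - (t - 0) *\<^sub>R skew_mat p q) \<le> e * norm (t - 0)"
        using d(1) d'(1) by (intro exI[of _ "min d d'"]) auto
    qed
  qed
qed

text \<open>Each factor rotates the plane of \<open>p\<close>, \<open>q\<close> to first order by half the entry of \<open>S\<close> at \<open>(p, q)\<close>; over all ordered pairs, the
  derivative at zero becomes the skew part of \<open>S\<close>.\<close>
lemma approximable_product_chart:
  assumes rot: "\<And>p q. rotatable p q" and "finite P"
  shows "\<exists>F. (\<forall>r. approximable (cball 0 r) F) \<and> F 0 = mat 1 \<and>
    (F has_derivative (\<lambda>S :: real^'n^'n. \<Sum>(p, q)\<in>P. (S $ p $ q / 2) *\<^sub>R skew_mat p q)) (at 0)"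
  using assms(2)
proof (induction P rule: finite_induct)
  case empty
  show ?case
    by (intro exI[of _ "\<lambda>_. mat 1"]) (auto intro: approximable_if_in_semigroup mat_1_mem)
next
  case (insert pq P)
  obtain p q where pq: "pq = (p, q)" by (cases pq)
  obtain F where F: "\<And>r. approximable (cball 0 r) F" "F 0 = mat 1"
    "(F has_derivative (\<lambda>S :: real^'n^'n. \<Sum>(p, q)\<in>P. (S $ p $ q / 2) *\<^sub>R skew_mat p q)) (at 0)"
    using insert.IH by blast
  obtain f where f: "\<And>T. approximable {-T..T} f" "f 0 = mat 1" "(f has_vector_derivative skew_mat p q) (at 0)"
    by (rule two_sided_curve[OF rot], rule that)
  let ?s = "\<lambda>S :: real^'n^'n. S $ p $ q / 2"
  have s: "bounded_linear ?s"
    by (intro bounded_linear_divide bounded_linear_compose[OF bounded_linear_vec_nth bounded_linear_vec_nth]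
        bounded_linear_compose[OF bounded_linear_divide])
  have "(f has_derivative (\<lambda>t. t *\<^sub>R skew_mat p q)) (at (?s 0))"
    using f(3) by (simp add: has_vector_derivative_def)
  from has_derivative_compose[OF bounded_linear_imp_has_derivative[OF s] this]
  have df: "((\<lambda>S. f (?s S)) has_derivative (\<lambda>S. ?s S *\<^sub>R skew_mat p q)) (at 0)" .
  have "((\<lambda>S. f (?s S) ** F S) has_derivative
      (\<lambda>S. f (?s 0) ** (\<Sum>(p, q)\<in>P. (S $ p $ q / 2) *\<^sub>R skew_mat p q) + (?s S *\<^sub>R skew_mat p q) ** F 0)) (at 0)"
    by (rule mm.FDERIV[OF df F(3)])
  then have "((\<lambda>S. f (?s S) ** F S) has_derivative
      (\<lambda>S. \<Sum>(p, q)\<in>insert pq P. (S $ p $ q / 2) *\<^sub>R skew_mat p q)) (at 0)"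
    using insert.hyps by (simp add: pq f(2) F(2) add.commute)
  moreover have "approximable (cball 0 r) (\<lambda>S. f (?s S) ** F S)" for r
  proof (intro approximable_mult F(1) approximable_compose[OF f(1)[of r]])
    show "continuous_on (cball 0 r) ?s"
      by (rule bounded_linear.continuous_on[OF s continuous_on_id])
    fix S :: "real^'n^'n" assume "S \<in> cball 0 r"
    moreover have "\<bar>S $ p $ q\<bar> \<le> norm S"
      unfolding real_norm_def[symmetric]
      by (rule order_trans[OF Finite_Cartesian_Product.norm_nth_le Finite_Cartesian_Product.norm_nth_le])
    ultimately have "\<bar>S $ p $ q\<bar> \<le> r" by simp
    then show "?s S \<in> {-r..r}" by auto
  qed
  ultimately show ?case
    by (intro exI[of _ "\<lambda>S. f (?s S) ** F S"]) (simp add: f(2) F(2))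
qed

text \<open>Let \<open>F\<close> be the product chart and \<open>g\<close> a continuous \<open>R\<close>-valued map uniformly close to it. On a small
  ball of skew matrices, \<open>skew_part (g S)\<close> is within \<open>r / 2\<close> of \<open>S\<close>: a quarter of the radius for the
  first-order error of \<open>F\<close>, another quarter for \<open>g - F\<close>. Hence for \<open>norm y \<le> r / 2\<close> the map
  \<open>S - skew_part (g S) + y\<close> preserves the ball, and a fixed point solves \<open>skew_part (g S) = y\<close>. If \<open>y\<close>
  is the skew part of a rotation \<open>Q\<close> near \<open>1\<close>, then \<open>g S = Q\<close> because both are close to \<open>1\<close>.\<close>
lemma contains_neighbourhood_of_identity:
  assumes rot: "\<And>p q. rotatable p q"
  obtains d where "d > 0" "\<And>Q. Q \<in> SO_group \<Longrightarrow> norm (Q - mat 1) < d \<Longrightarrow> Q \<in> R"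
proof -
  obtain F where F: "\<And>r. approximable (cball 0 r) F" "F 0 = mat 1"
    "(F has_derivative (\<lambda>S :: real^'n^'n. \<Sum>(p, q)\<in>UNIV. (S $ p $ q / 2) *\<^sub>R skew_mat p q)) (at 0)"
    using approximable_product_chart[OF rot finite] by blast
  have "(\<Sum>(p, q)\<in>UNIV. (S $ p $ q / 2) *\<^sub>R skew_mat p q) = skew_part S" for S :: "real^'n^'n"
  proof -
    have "(\<Sum>(p, q)\<in>UNIV. (S $ p $ q / 2) *\<^sub>R skew_mat p q)
        = (\<Sum>p\<in>UNIV. \<Sum>q\<in>UNIV. ((1/2) *\<^sub>R S) $ p $ q *\<^sub>R skew_mat p q)"
      unfolding UNIV_Times_UNIV[symmetric] sum.cartesian_product[symmetric] by simp
    then show ?thesis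
      unfolding skew_mat_sum by (simp add: skew_part_def transpose_scalar scaleR_diff_right)
  qed
  with F(3) have dF: "(F has_derivative skew_part) (at 0)"
    by simp
  have dh: "((\<lambda>S. skew_part (F S)) has_derivative (\<lambda>S. skew_part (skew_part S))) (at 0)"
    by (rule bounded_linear.has_derivative[OF bounded_linear_skew_part dF])
  obtain d1 where d1: "d1 > 0" "\<And>S. norm S < d1 \<Longrightarrow>
      norm (skew_part (F S) - skew_part (skew_part S)) \<le> 1/4 * norm S"
  proof -
    have "\<exists>d>0. \<forall>S. norm (S - 0) < d \<longrightarrow>
      norm (skew_part (F S) - skew_part (F 0) - skew_part (skew_part (S - 0))) \<le> 1/4 * norm (S - 0)"
      using dh[unfolded has_derivative_at_alt] by (elim conjE) (erule allE[of _ "1/4"], simp)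
    then show thesis
      using that by (auto simp: F(2) skew_part_mat_1)
  qed
  obtain d2 where d2: "d2 > 0" "\<And>S. norm S < d2 \<Longrightarrow> norm (F S - mat 1) < 1/2"
  proof -
    have "isCont F 0"
      by (rule has_derivative_continuous[OF dF])
    then have "\<exists>d>0. \<forall>S. dist S 0 < d \<longrightarrow> dist (F S) (F 0) < 1/2"
      unfolding continuous_at_eps_delta by (erule_tac allE[of _ "1/2"]) simp
    then show thesis
      using that by (auto simp: F(2) dist_norm)
  qed
  define r where "r = min d1 d2 / 2"
  have r: "0 < r" "r < d1" "r < d2"
    using d1(1) d2(1) by (auto simp: r_def)
  have "min (r/4) (1/2) > 0" using r by simp
  then obtain g where g: "continuous_on (cball 0 r) g"
      "\<And>S. S \<in> cball 0 r \<Longrightarrow> g S \<in> R \<and> norm (g S - F S) < min (r/4) (1/2)"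
    using F(1)[of r] unfolding approximable_def by blast
  let ?D = "so_algebra \<inter> cball 0 r :: (real^'n^'n) set"
  have D: "compact ?D" "convex ?D" "?D \<noteq> {}"
  proof -
    show "compact ?D"
      by (intro closed_Int_compact closed_subspace subspace_so_algebra compact_cball)
    show "convex ?D"
      by (intro convex_Int subspace_imp_convex subspace_so_algebra convex_cball)
    show "?D \<noteq> {}"
      using subspace_0[OF subspace_so_algebra] r by (auto intro!: exI[of _ 0])
  qed
  have hit: "\<exists>S\<in>?D. skew_part (g S) = y" if y: "y \<in> so_algebra" "norm y \<le> r / 2" for y
  proof -
    let ?\<phi> = "\<lambda>S. S - skew_part (g S) + y"
    have "continuous_on ?D ?\<phi>"
      by (intro continuous_on_add continuous_on_diff continuous_on_id continuous_on_const
          bounded_linear.continuous_on[OF bounded_linear_skew_part] continuous_on_subset[OF g(1)]) auto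
    moreover have "?\<phi> \<in> ?D \<rightarrow> ?D"
    proof
      fix S assume S: "S \<in> ?D"
      have "norm (skew_part (F S) - S) \<le> 1/4 * norm S"
        using d1(2)[of S] S r by (simp add: skew_part_eq)
      moreover have "norm (skew_part (F S - g S)) \<le> r/4"
        using norm_skew_part_le[of "F S - g S"] g(2)[of S] S by (simp add: norm_minus_commute)
      moreover have "?\<phi> S = - (skew_part (F S) - S) + skew_part (F S - g S) + y"
        by (simp add: linear_diff[OF bounded_linear.linear[OF bounded_linear_skew_part]])
      then have "norm (?\<phi> S) \<le> norm (skew_part (F S) - S) + norm (skew_part (F S - g S)) + norm y"
        by (metis norm_minus_cancel norm_triangle_mono norm_triangle_ineq order_refl)
      ultimately have "norm (?\<phi> S) \<le> r"
        using y(2) S by simp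
      moreover have "?\<phi> S \<in> so_algebra"
        using S y(1) by (intro subspace_add subspace_diff subspace_so_algebra skew_part_in_so_algebra) auto
      ultimately show "?\<phi> S \<in> ?D" by simp
    qed
    ultimately obtain S where "S \<in> ?D" "?\<phi> S = S"
      by (rule brouwer[OF D])
    then show ?thesis
      by (intro bexI[of _ S]) auto
  qed
  show thesis
  proof (rule that)
    show "min 1 (r / 2) > 0" using r by simp
    fix Q :: "real^'n^'n" assume Q: "Q \<in> SO_group" "norm (Q - mat 1) < min 1 (r / 2)"
    have "norm (skew_part Q) \<le> norm (Q - mat 1)"
      using norm_skew_part_le[of "Q - mat 1"]
      by (simp add: linear_diff[OF bounded_linear.linear[OF bounded_linear_skew_part]] skew_part_mat_1)
    then obtain S where S: "S \<in> ?D" "skew_part (g S) = skew_part Q"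
      using hit[OF skew_part_in_so_algebra, of Q] Q(2) by auto
    have gS: "g S \<in> R" "norm (g S - F S) < 1/2"
      using g(2)[of S] S(1) by auto
    have "norm (F S - mat 1) < 1/2"
      using d2(2)[of S] S(1) r by auto
    then have "norm (g S - mat 1) < 1"
      using gS(2) norm_triangle_ineq[of "g S - F S" "F S - mat 1"] by simp
    moreover have "orthogonal_matrix (g S)" "orthogonal_matrix Q"
      using gS(1) subset_SO_group Q(1) unfolding SO_group_def by blast+
    ultimately have "g S = Q"
      using Q(2) by (intro skew_part_inj_near_mat_1[OF _ _ _ _ S(2)]) simp_all
    then show "Q \<in> R" using gS(1) by simp
  qed
qed

text \<open>Choose \<open>P\<close> in \<open>R\<close> so close to \<open>Q\<close> that \<open>Q P\<^sup>T\<close> lies in the neighbourhood of the identity contained in \<open>R\<close>.\<close>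
lemma eq_SO_group_if_all_rotatable:
  assumes rot: "\<And>p q. rotatable p q"
  shows "R = SO_group"
proof (rule equalityI[OF subset_SO_group], rule subsetI)
  fix Q :: "real^'n^'n" assume Q: "Q \<in> SO_group"
  obtain d where d: "d > 0" "\<And>Q. Q \<in> SO_group \<Longrightarrow> norm (Q - mat 1) < d \<Longrightarrow> Q \<in> R"
    by (rule contains_neighbourhood_of_identity[OF rot], rule that)
  have "Q \<in> closure R"
    using Q dense_if_all_rotatable[OF rot] by simp
  then obtain P where P: "P \<in> R" "norm (P - Q) < d"
    using d(1) unfolding closure_approachable dist_norm by blast
  have oP: "P \<in> SO_group" "transpose P ** P = mat 1" "P ** transpose P = mat 1" "orthogonal_matrix (transpose P)"
  proof -
    show 1: "P \<in> SO_group" using P(1) subset_SO_group by blast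
    then show "orthogonal_matrix (transpose P)" by (simp add: SO_group_def)
    show "transpose P ** P = mat 1" "P ** transpose P = mat 1"
      using 1 by (simp_all add: SO_group_def orthogonal_matrix_def)
  qed
  have "Q ** transpose P - mat 1 = (Q - P) ** transpose P"
    using oP by (simp add: mm.diff_left)
  then have "norm (Q ** transpose P - mat 1) < d"
    using P(2) oP(4) by (simp add: norm_orthogonal_mult_right norm_minus_commute)
  then have "Q ** transpose P \<in> R"
    using Q oP(1) by (intro d(2) SO_group_mult) (auto simp: SO_group_transpose)
  from mult_mem[OF this P(1)] show "Q \<in> R"
    using oP(2) by (simp flip: matrix_mul_assoc)
qed

end

section \<open>Controllability\<close>

lemma connected_imp_controllable:
  fixes A :: "real^'n^'n"
  assumes A: "A \<in> so_algebra" and ij: "\<And>k. k \<in> {1..m} \<Longrightarrow> i k \<noteq> j k"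
    and card: "\<And>C. C \<in> graph_components (contr_edges m i j) \<Longrightarrow> card C \<ge> 3"
    and con: "connected_graph (drift_edges A \<union> contr_edges m i j)"
  shows "controllable A m i j"
proof -
  interpret SO_semigroup "reachable A m i j"
    by (rule SO_semigroup_reachable[OF A])
  have contr: "rotatable x y" if edge: "{x, y} \<in> contr_edges m i j" for x y
  proof -
    obtain k where k: "k \<in> {1..m}" "{x, y} = {i k, j k}"
      using edge by (auto simp: contr_edges_def)
    have "rotatable (i k) (j k)"
      by (rule controlled_pair_rotatable[where i = i and j = j and m = m, OF A k(1) ij[OF k(1)]])
    then show ?thesis
      using k(2) rotatable_sym by (auto simp: doubleton_eq_iff)
  qed
  have joined: "rotatable x y" if "(x, y) \<in> joined E" "\<And>x y. {x, y} \<in> E \<Longrightarrow> rotatable x y" for x y E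
    using that(1) unfolding joined_def
    by (induction rule: rtrancl_induct) (auto simp: adjacency_def intro: rotatable_refl rotatable_trans that(2))
  have card3: "card {y. rotatable x y} \<ge> 3" for x
  proof -
    have "card (joined (contr_edges m i j) `` {x}) \<ge> 3"
      by (intro card) (auto simp: graph_components_def intro: quotientI)
    also have "card (joined (contr_edges m i j) `` {x}) \<le> card {y. rotatable x y}"
      using joined[OF _ contr] by (intro card_mono) auto
    finally show ?thesis .
  qed
  have "rotatable x y" if edge: "{x, y} \<in> drift_edges A" for x y
  proof -
    obtain p q where "{x, y} = {p, q}" "A $ p $ q \<noteq> 0"
      using edge by (auto simp: drift_edges_def)
    moreover from this have "rotatable p q"
      using drift_edge_rotatable[OF drift_in_tangent_cone[OF A] A _ card3] by blast
    ultimately show ?thesis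
      using rotatable_sym by (auto simp: doubleton_eq_iff)
  qed
  with contr have edge: "rotatable x y" if "{x, y} \<in> drift_edges A \<union> contr_edges m i j" for x y
    using that by blast
  have "rotatable x y" for x y
  proof (cases "x = y")
    case False
    with con have "(x, y) \<in> joined (drift_edges A \<union> contr_edges m i j)"
      by (simp add: connected_graph_def)
    then show ?thesis
      by (rule joined) (rule edge)
  qed (simp add: rotatable_refl)
  then show ?thesis
    unfolding controllable_def by (rule eq_SO_group_if_all_rotatable)
qed

theorem theorem2:
  fixes A :: "real^'n::{finite,linorder}^'n::{finite,linorder}"
    and m :: nat
    and i j :: "nat \<Rightarrow> 'n"
  assumes "A \<in> so_algebra"
    and "\<And>k. k \<in> {1..m} \<Longrightarrow> i k < j k"
    and "\<And>C. C \<in> graph_components (contr_edges m i j) \<Longrightarrow> card C \<ge> 3"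
  shows "controllable A m i j \<longleftrightarrow> connected_graph (drift_edges A \<union> contr_edges m i j)"
proof
  show "connected_graph (drift_edges A \<union> contr_edges m i j)" if "controllable A m i j"
    by (rule controllable_imp_connected[OF assms(1) that])
  show "controllable A m i j" if "connected_graph (drift_edges A \<union> contr_edges m i j)"
    using assms(2) by (intro connected_imp_controllable[OF assms(1) _ assms(3) that]) (auto dest: less_imp_neq)
qed

end
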